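(* Let $M$ be a compact topological manifold supporting a Borel probability measure $\mu$. Consider a family of embeddings of $M$ into Euclidean spaces ${\mathbf R}^d$, $d\to\infty$, as a submanifold, such that for each $\varepsilon>0$ the Euclidean covering numbers $N(M,\varepsilon)$ of the image grow as $o(d)$. Let $\sigma=\sigma(d)=O(1/\sqrt d)$ and let $\gamma_d(0,\sigma^2)$ be the centered Gaussian measure on ${\mathbf R}^d$ with covariance $\sigma^2 I_d$. Then the Gromov distance between the image of $(M,\mu)$ in ${\mathbf R}^d$ (with the Euclidean distance and the push-forward of $\mu$) and its corruption $({\mathbf R}^d,\|\cdot\|,\mu\ast\gamma_d(0,\sigma^2))$ tends to zero as $d\to\infty$.
   Context: $N(M,\varepsilon)$ is the smallest number of open Euclidean balls of radius $\varepsilon$ covering $M$. $\mu\ast\gamma_d$ denotes convolution of measures on ${\mathbf R}^d$ (the $mm$-space "corruption" of $(M,\mu)$ by Gaussian noise). For a metric space with Borel probability measure $(X,d,\mu)$: ${\mathrm{Lip}}_1(X)$ is the set of real-valued 1-Lipschitz functions; a parametrization is a measurable $\phi\colon[0,1]\to X$ with $\mu(A)=\lambda(\phi^{-1}(A))$ for all Borel $A$. For measurable $f,g$ on $[0,1]$, ${\mathrm{me}}_1(f,g)=\inf\{\varepsilon>0\colon \lambda\{t\colon |f(t)-g(t)|>\varepsilon\}<\varepsilon\}$. The Gromov distance $d_{conc}(X,Y)$ is the infimum of all $\varepsilon>0$ for which there exist parametrizations $\phi_X,\phi_Y$ such that every $f\in{\mathrm{Lip}}_1(X)$ has some $g\in{\mathrm{Lip}}_1(Y)$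 with ${\mathrm{me}}_1(f\circ\phi_X,g\circ\phi_Y)<\varepsilon$, and vice versa. *)

theory Defs
  imports "HOL-Probability.Probability" "HOL-Library.Landau_Symbols"
begin

definition topological_manifold :: "'a topology \<Rightarrow> bool" where
  "topological_manifold M \<longleftrightarrow> Hausdorff_space M \<and> second_countable M \<and>
     (\<exists>n. \<forall>x\<in>topspace M. \<exists>U V. openin M U \<and> x \<in> U \<and> openin (Euclidean_space n) V \<and>
         (subtopology M U) homeomorphic_space (subtopology (Euclidean_space n) V))"

definition borel_of :: "'a topology \<Rightarrow> 'a measure" where
  "borel_of M = sigma (topspace M) {U. openin M U}"

text \<open>Points of R^d are represented as extensional functions on {..<d}
  (the carrier of the product measure / product topology).\<close>
definition Rspace :: "nat \<Rightarrow> (nat \<Rightarrow> real) set" where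
  "Rspace d = PiE {..<d} (\<lambda>_. UNIV)"

definition Rtop :: "nat \<Rightarrow> (nat \<Rightarrow> real) topology" where
  "Rtop d = product_topology (\<lambda>_. euclideanreal) {..<d}"

definition Rborel :: "nat \<Rightarrow> (nat \<Rightarrow> real) measure" where
  "Rborel d = PiM {..<d} (\<lambda>_. lborel)"

definition edist :: "nat \<Rightarrow> (nat \<Rightarrow> real) \<Rightarrow> (nat \<Rightarrow> real) \<Rightarrow> real" where
  "edist d x y = sqrt (\<Sum>i<d. (x i - y i)\<^sup>2)"

definition covering_number :: "nat \<Rightarrow> (nat \<Rightarrow> real) set \<Rightarrow> real \<Rightarrow> nat" where
  "covering_number d S e = (LEAST n. \<exists>C. finite C \<and> card C = n \<and> C \<subseteq> Rspace d \<and>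
      S \<subseteq> (\<Union>c\<in>C. {x \<in> Rspace d. edist d c x < e}))"

definition gauss1 :: "real \<Rightarrow> real measure" where
  "gauss1 s = (if s = 0 then return lborel 0 else density lborel (normal_density 0 s))"

definition gaussian :: "nat \<Rightarrow> real \<Rightarrow> (nat \<Rightarrow> real) measure" where
  "gaussian d s = PiM {..<d} (\<lambda>_. gauss1 s)"

definition conv :: "nat \<Rightarrow> (nat \<Rightarrow> real) measure \<Rightarrow> (nat \<Rightarrow> real) measure \<Rightarrow> (nat \<Rightarrow> real) measure" where
  "conv d \<mu> \<nu> = distr (\<mu> \<Otimes>\<^sub>M \<nu>) (Rborel d) (\<lambda>(x, y). \<lambda>i\<in>{..<d}. x i + y i)"

text \<open>An mm-space is given by a distance function and a Borel probability measure;
  its underlying set is the space of the measure.\<close>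
definition Lip1 :: "('b \<Rightarrow> 'b \<Rightarrow> real) \<Rightarrow> 'b measure \<Rightarrow> ('b \<Rightarrow> real) set" where
  "Lip1 \<delta> \<nu> = {f. \<forall>x\<in>space \<nu>. \<forall>y\<in>space \<nu>. \<bar>f x - f y\<bar> \<le> \<delta> x y}"

definition unit_lebesgue :: "real measure" where
  "unit_lebesgue = restrict_space lebesgue {0..1}"

definition parametrization :: "'b measure \<Rightarrow> (real \<Rightarrow> 'b) \<Rightarrow> bool" where
  "parametrization \<nu> \<phi> \<longleftrightarrow> \<phi> \<in> unit_lebesgue \<rightarrow>\<^sub>M \<nu> \<and>
     (\<forall>A \<in> sets \<nu>. measure \<nu> A = measure unit_lebesgue (\<phi> -` A \<inter> space unit_lebesgue))"

definition me1 :: "(real \<Rightarrow> real) \<Rightarrow> (real \<Rightarrow> real) \<Rightarrow> real" where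
  "me1 f g = Inf {e. e > 0 \<and> measure lebesgue {t \<in> {0..1}. \<bar>f t - g t\<bar> > e} < e}"

definition d_conc :: "('b \<Rightarrow> 'b \<Rightarrow> real) \<Rightarrow> 'b measure \<Rightarrow> ('c \<Rightarrow> 'c \<Rightarrow> real) \<Rightarrow> 'c measure \<Rightarrow> real" where
  "d_conc \<delta>X \<nu>X \<delta>Y \<nu>Y = Inf {e. e > 0 \<and> (\<exists>\<phi>X \<phi>Y. parametrization \<nu>X \<phi>X \<and> parametrization \<nu>Y \<phi>Y \<and>
      (\<forall>f\<in>Lip1 \<delta>X \<nu>X. \<exists>g\<in>Lip1 \<delta>Y \<nu>Y. me1 (f \<circ> \<phi>X) (g \<circ> \<phi>Y) < e) \<and>
      (\<forall>g\<in>Lip1 \<delta>Y \<nu>Y. \<exists>f\<in>Lip1 \<delta>X \<nu>X. me1 (f \<circ> \<phi>X) (g \<circ> \<phi>Y) < e))}"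

end

theory Submission
  imports Defs
begin

text \<open>Let \<open>X\<close> be the image of \<open>M\<close>, \<open>x\<close> a random point of \<open>X\<close> and \<open>z\<close> Gaussian noise. Both spaces
  are parametrized by a joint parametrization of \<open>(x, z)\<close>, through \<open>x\<close> and \<open>x + z\<close>.

  A 1-Lipschitz \<open>g\<close> on \<open>R^d\<close> is matched with \<open>f x = E g (x + z)\<close>: by Gaussian concentration
  \<open>g (x + z)\<close> is close to \<open>f x\<close> outside a set of measure \<open>2 exp (- c d e^2)\<close>.

  Conversely, \<open>z\<close> has norm of order 1, so a Lipschitz extension of \<open>f\<close> need not be close to \<open>f x\<close>
  at \<open>x + z\<close>. But the noise is almost orthogonal to \<open>X\<close>: by concentration and a
  union bound over the (at most \<open>d^2\<close>) differences of centres of a finite cover of \<open>X\<close>, there is a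
  set \<open>G\<close> of noise vectors of almost full measure such that
  \<open>|(x + z) - (y + z')| \<ge> |x - y| - e\<close> for \<open>x, y\<close> in \<open>X\<close> and \<open>z, z'\<close> in \<open>G\<close>. Hence
  \<open>x + z \<mapsto> f x\<close> is Lipschitz up to \<open>e\<close> and extends to a 1-Lipschitz function.

  Gaussian concentration is derived from Maurey's property (tau), which tensorizes and
  follows in dimension one from the Prekopa-Leindler inequality.\<close>

section \<open>The Brunn-Minkowski inequality on the line\<close>

text \<open>Inner regularity is available for finite measures, so \<open>A\<close> is first cut down
  to an interval \<open>{- n..n}\<close> on which more than \<open>a\<close> of the measure is
  left.\<close>

lemma lborel_inner_compact:
  fixes A :: "real set"
  assumes A: "A \<in> sets borel" and a: "a < emeasure lborel A"
  obtains K where "compact K" "K \<subseteq> A" "a < emeasure lborel K"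
proof -
  have "emeasure lborel A = (SUP n. emeasure lborel (A \<inter> {- real n..real n}))"
  proof (subst SUP_emeasure_incseq)
    show "incseq (\<lambda>n. A \<inter> {- real n..real n})"
      by (auto simp: incseq_def)
    have "(\<Union>n. A \<inter> {- real n..real n}) = A"
    proof safe
      fix x assume "x \<in> A"
      obtain n where "\<bar>x\<bar> \<le> real n" using real_arch_simple by blast
      then show "x \<in> (\<Union>n. A \<inter> {- real n..real n})" using \<open>x \<in> A\<close> by (auto simp: abs_le_iff intro!: exI[of _ n])
    qed
    then show "emeasure lborel A = emeasure lborel (\<Union>n. A \<inter> {- real n..real n})" by simp
  qed (use A in auto)
  with a obtain n where n: "a < emeasure lborel (A \<inter> {- real n..real n})"
    by (auto simp: less_SUP_iff)
  \<comment> \<open>Lebesgue measure restricted to the interval: a finite measure, which makes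
    \<open>inner_regular\<close> applicable.\<close>
  define M where "M = density lborel (indicator {- real n..real n})"
  have M: "emeasure M B = emeasure lborel (B \<inter> {- real n..real n})" if "B \<in> sets borel" for B
    using that unfolding M_def by (subst emeasure_restricted) (auto simp: Int_commute)
  have "emeasure M A = (SUP K \<in> {K. K \<subseteq> A \<and> compact K}. emeasure M K)"
  proof (rule inner_regular)
    show "emeasure M (space M) \<noteq> \<infinity>"
      using M[of UNIV] by (simp add: M_def)
  qed (use A in \<open>auto simp: M_def\<close>)
  then obtain K where K: "K \<subseteq> A" "compact K" "a < emeasure M K"
    using n A by (auto simp: M less_SUP_iff)
  show ?thesis
  proof (rule that)
    show "compact (K \<inter> {- real n..real n})" using K by (intro compact_Int) auto
    show "K \<inter> {- real n..real n} \<subseteq> A" using K by auto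
    show "a < emeasure lborel (K \<inter> {- real n..real n})"
      using K by (simp add: M borel_compact)
  qed
qed

text \<open>Translate \<open>K\<close> by the least element \<open>b\<close> of \<open>L\<close>,
  and \<open>L\<close> by the largest element \<open>a\<close> of \<open>K\<close>. Both translates
  lie in \<open>D\<close>; the first lies to the left of \<open>a + b\<close>, the second to the
  right, so they overlap only in that point and their measures add up.\<close>

lemma Brunn_Minkowski_compact:
  fixes K L D :: "real set"
  assumes K: "compact K" "K \<noteq> {}" and L: "compact L" "L \<noteq> {}" and D: "D \<in> sets borel"
    and sub: "\<And>x y. x \<in> K \<Longrightarrow> y \<in> L \<Longrightarrow> x + y \<in> D"
  shows "emeasure lborel K + emeasure lborel L \<le> emeasure lborel D"
proof -
  obtain a where a: "a \<in> K" "\<And>x. x \<in> K \<Longrightarrow> x \<le> a" using compact_attains_sup[OF K] by blast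
  obtain b where b: "b \<in> L" "\<And>y. y \<in> L \<Longrightarrow> b \<le> y" using compact_attains_inf[OF L] by blast
  have shift: "emeasure lborel ((\<lambda>x. c + x) ` S) = emeasure lborel S" if "compact S" for c and S :: "real set"
  proof -
    have "emeasure lborel S = emeasure (distr lborel borel ((+) (-c))) S" by (simp add: lborel_distr_plus)
    also have "\<dots> = emeasure lborel ((+) (-c) -` S)"
      using that by (subst emeasure_distr) (auto simp: borel_compact)
    also have "(+) (-c) -` S = (\<lambda>x. c + x) ` S"
      by (force simp: image_iff)
    finally show ?thesis by simp
  qed
  let ?P = "(\<lambda>x. b + x) ` K" and ?Q = "(\<lambda>x. a + x) ` L"
  have cpt: "compact ?P" "compact ?Q"
    using K L by (auto intro!: compact_translation)
  have "emeasure lborel K + emeasure lborel L = emeasure lborel ?P + emeasure lborel ?Q"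
    using K L by (simp add: shift)
  \<comment> \<open>Deleting the common point \<open>a + b\<close>, a null set, makes the two
    translates disjoint.\<close>
  also have "emeasure lborel ?P = emeasure lborel (?P - {a + b})"
    using cpt by (intro emeasure_Diff_null_set[symmetric]) (auto simp: borel_compact)
  also have "emeasure lborel (?P - {a + b}) + emeasure lborel ?Q = emeasure lborel ((?P - {a + b}) \<union> ?Q)"
    using cpt a b by (intro plus_emeasure) (auto simp: borel_compact, force)
  also have "\<dots> \<le> emeasure lborel D"
  proof (rule emeasure_mono)
    show "?P - {a + b} \<union> ?Q \<subseteq> D"
      using sub[OF _ b(1)] sub[OF a(1)] by (auto simp: add.commute[of b])
  qed (use D in auto)
  finally show ?thesis .
qed

text \<open>The set of midpoints of two Borel sets need not be Borel, hence the formulation with a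
  Borel set \<open>D\<close> containing it. Doubling \<open>D\<close> turns midpoints into sums; the
  compact case is then applied to compact subsets that nearly exhaust \<open>A\<close> and
  \<open>B\<close>.\<close>

lemma Brunn_Minkowski_real:
  fixes A B D :: "real set"
  assumes A: "A \<in> sets borel" "A \<noteq> {}" and B: "B \<in> sets borel" "B \<noteq> {}" and D: "D \<in> sets borel"
    and sub: "\<And>x y. x \<in> A \<Longrightarrow> y \<in> B \<Longrightarrow> (x + y) / 2 \<in> D"
  shows "emeasure lborel A + emeasure lborel B \<le> 2 * emeasure lborel D"
proof -
  let ?D = "(\<lambda>x. x / 2) -` D"
  have D': "?D \<in> sets borel" using D by (intro measurable_sets_borel[of _ borel]) auto
  have D2: "2 * emeasure lborel D = emeasure lborel ?D"
  proof -
    have "emeasure lborel ?D = (\<integral>\<^sup>+x. indicator ?D x \<partial>lborel)" using D' by simp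
    also have "\<dots> = ennreal \<bar>2\<bar> * (\<integral>\<^sup>+x. indicator ?D (0 + 2 * x) \<partial>lborel)"
      using D' by (intro nn_integral_real_affine) auto
    also have "(\<integral>\<^sup>+x. indicator ?D (0 + 2 * x) \<partial>lborel) = (\<integral>\<^sup>+x. indicator D x \<partial>lborel)"
      by (intro nn_integral_cong) (auto simp: indicator_def)
    finally show ?thesis using D by simp
  qed
  have *: "a + b \<le> emeasure lborel ?D" if a: "a < emeasure lborel A" and b: "b < emeasure lborel B" for a b
  proof -
    obtain K where K: "compact K" "K \<subseteq> A" "a < emeasure lborel K" by (rule lborel_inner_compact[OF A(1) a])
    obtain L where L: "compact L" "L \<subseteq> B" "b < emeasure lborel L" by (rule lborel_inner_compact[OF B(1) b])
    have "K \<noteq> {}" "L \<noteq> {}" using K L by auto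
    then have "emeasure lborel K + emeasure lborel L \<le> emeasure lborel ?D"
      using K L sub D' by (intro Brunn_Minkowski_compact) auto
    moreover have "a + b \<le> emeasure lborel K + emeasure lborel L" using K L by (intro add_mono) auto
    ultimately show ?thesis by simp
  qed
  \<comment> \<open>Fixing one point of the other set, a translate of \<open>A\<close> or of
    \<open>B\<close> alone fits into the doubled set. This settles the case in which one of the two
    is a null set.\<close>
  have pt: "emeasure lborel S \<le> emeasure lborel ?D" if "S = A \<or> S = B" for S
  proof -
    obtain x y where xy: "x \<in> A" "y \<in> B" using A B by auto
    have sh: "emeasure lborel S \<le> emeasure lborel ?D" if S: "S \<in> sets borel" "\<And>x. x \<in> S \<Longrightarrow> c + x \<in> ?D" for c S
    proof -
      have "emeasure lborel ?D = emeasure (distr lborel borel ((+) c)) ?D" by (simp add: lborel_distr_plus)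
      also have "\<dots> = emeasure lborel ((+) c -` ?D)" using D' by (subst emeasure_distr) auto
      also have "\<dots> \<ge> emeasure lborel S"
        using S measurable_sets_borel[OF _ D', of "(+) c"] by (intro emeasure_mono) auto
      finally show ?thesis .
    qed
    have "emeasure lborel A \<le> emeasure lborel ?D"
      by (rule sh[of A y]) (use A sub xy in \<open>auto simp: add.commute[of y]\<close>)
    moreover have "emeasure lborel B \<le> emeasure lborel ?D"
      by (rule sh[of B x]) (use B sub xy in auto)
    ultimately show ?thesis using that by auto
  qed
  have "emeasure lborel A + emeasure lborel B \<le> emeasure lborel ?D"
  \<comment> \<open>In the null case no number lies strictly below the measure, and the suprema over
    \<open>{..<x}\<close> used in the other case would be over an empty set.\<close>
  proof (cases "emeasure lborel A = 0 \<or> emeasure lborel B = 0")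
    case True
    then show "emeasure lborel A + emeasure lborel B \<le> emeasure lborel ?D" using pt[of A] pt[of B] by fastforce
  next
    case False
    then have pos: "0 < emeasure lborel A" "0 < emeasure lborel B" by (simp_all add: zero_less_iff_neq_zero)
    have SUP_less: "(SUP a\<in>{..<x}. a) = x" for x :: ennreal
      by (rule SUP_eqI) (auto intro: dense_le)
    have 1: "a + emeasure lborel B \<le> emeasure lborel ?D" if "a < emeasure lborel A" for a
    proof -
      have "a + (SUP b\<in>{..<emeasure lborel B}. b) = (SUP b\<in>{..<emeasure lborel B}. a + b)"
        by (rule ennreal_SUP_add_right) (use pos in blast)
      also have "\<dots> \<le> emeasure lborel ?D"
        using *[OF that] by (intro SUP_least) blast
      finally show ?thesis by (simp only: SUP_less)
    qed
    have "(SUP a\<in>{..<emeasure lborel A}. a) + emeasure lborel B = (SUP a\<in>{..<emeasure lborel A}. a + emeasure lborel B)"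
      by (rule ennreal_SUP_add_left[symmetric]) (use pos in blast)
    also have "\<dots> \<le> emeasure lborel ?D"
      using 1 by (intro SUP_least) blast
    finally show "emeasure lborel A + emeasure lborel B \<le> emeasure lborel ?D" by (simp only: SUP_less)
  qed
  then show ?thesis by (simp only: D2)
qed

section \<open>The Prekopa-Leindler inequality and property (tau)\<close>

lemma nn_integral_layer_cake_le_1:
  fixes u :: "real \<Rightarrow> real"
  assumes [measurable]: "u \<in> borel_measurable borel" and u: "\<And>x. 0 \<le> u x" "\<And>x. u x \<le> 1"
  shows "(\<integral>\<^sup>+x. ennreal (u x) \<partial>lborel) = (\<integral>\<^sup>+r\<in>{0<..<1}. emeasure lborel {x. r < u x} \<partial>lborel)"
proof -
  have "(\<integral>\<^sup>+x. ennreal (u x) \<partial>lborel) = (\<integral>\<^sup>+x. (\<integral>\<^sup>+r. indicator {0<..<1} r * indicator {x. r < u x} x \<partial>lborel) \<partial>lborel)"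
  proof (intro nn_integral_cong)
    fix x
    have "(\<integral>\<^sup>+r. indicator {0<..<1} r * indicator {x. r < u x} x \<partial>lborel) = (\<integral>\<^sup>+r. indicator {0<..<u x} r \<partial>lborel)"
      using u(2)[of x] by (intro nn_integral_cong) (auto simp: indicator_def)
    also have "\<dots> = ennreal (u x)" using u(1)[of x] by simp
    finally show "ennreal (u x) = (\<integral>\<^sup>+r. indicator {0<..<1} r * indicator {x. r < u x} x \<partial>lborel)" by simp
  qed
  also have "\<dots> = (\<integral>\<^sup>+r. (\<integral>\<^sup>+x. indicator {0<..<1} r * indicator {x. r < u x} x \<partial>lborel) \<partial>lborel)"
    by (rule lborel_pair.Fubini') measurable
  also have "\<dots> = (\<integral>\<^sup>+r\<in>{0<..<1}. emeasure lborel {x. r < u x} \<partial>lborel)"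
    by (intro nn_integral_cong) (simp add: nn_integral_cmult mult.commute)
  finally show ?thesis .
qed

text \<open>Since \<open>u\<close> and \<open>v\<close> both have supremum 1, at every level
  \<open>r\<close> in (0,1) both superlevel sets are nonempty and their midpoints lie in the
  superlevel set of \<open>h\<close>. Brunn-Minkowski at each level, integrated over
  \<open>r\<close>, gives the additive form of the inequality.\<close>

lemma Prekopa_Leindler_normalised:
  fixes u v h :: "real \<Rightarrow> real"
  assumes [measurable]: "u \<in> borel_measurable borel" "v \<in> borel_measurable borel" "h \<in> borel_measurable borel"
    and u: "\<And>x. 0 \<le> u x" "\<And>x. u x \<le> 1" "\<And>r. r < 1 \<Longrightarrow> \<exists>x. r < u x"
    and v: "\<And>x. 0 \<le> v x" "\<And>x. v x \<le> 1" "\<And>r. r < 1 \<Longrightarrow> \<exists>x. r < v x"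
    and h: "\<And>x. 0 \<le> h x"
    and uvh: "\<And>x y. u x * v y \<le> (h ((x + y) / 2))\<^sup>2"
  shows "(\<integral>\<^sup>+x. ennreal (u x) \<partial>lborel) + (\<integral>\<^sup>+x. ennreal (v x) \<partial>lborel) \<le> 2 * (\<integral>\<^sup>+x. ennreal (h x) \<partial>lborel)"
proof -
  let ?m = "\<lambda>f r. emeasure lborel {x. r < f x} * indicator {0<..<1} r"
  have [measurable]: "?m f \<in> borel_measurable lborel" if [measurable]: "f \<in> borel_measurable borel" for f :: "real \<Rightarrow> real"
    by measurable
  have "(\<integral>\<^sup>+x. ennreal (u x) \<partial>lborel) + (\<integral>\<^sup>+x. ennreal (v x) \<partial>lborel) = (\<integral>\<^sup>+r. ?m u r + ?m v r \<partial>lborel)"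
    using u v by (simp add: nn_integral_layer_cake_le_1 nn_integral_add)
  \<comment> \<open>Capping \<open>h\<close> at 1 leaves its superlevel sets at levels below 1
    unchanged and makes the layer cake formula applicable to it.\<close>
  also have "\<dots> \<le> (\<integral>\<^sup>+r. 2 * ?m (\<lambda>x. min (h x) 1) r \<partial>lborel)"
  proof (intro nn_integral_mono)
    fix r :: real
    have "emeasure lborel {x. r < u x} + emeasure lborel {x. r < v x} \<le> 2 * emeasure lborel {x. r < min (h x) 1}"
      if r: "0 < r" "r < 1"
    proof (rule Brunn_Minkowski_real)
      fix x y assume "x \<in> {x. r < u x}" "y \<in> {x. r < v x}"
      then have "r * r < u x * v y" using r by (intro mult_strict_mono) auto
      also have "\<dots> \<le> (h ((x + y) / 2))\<^sup>2" by (rule uvh)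
      finally have "r < h ((x + y) / 2)" 
        by (metis power2_eq_square power_less_imp_less_base h)
      then show "(x + y) / 2 \<in> {x. r < min (h x) 1}" using r by simp
    qed (use u v r in auto)
    then show "?m u r + ?m v r \<le> 2 * ?m (\<lambda>x. min (h x) 1) r"
      by (auto simp: indicator_def)
  qed
  also have "\<dots> = 2 * (\<integral>\<^sup>+x. ennreal (min (h x) 1) \<partial>lborel)"
    using h by (simp add: nn_integral_layer_cake_le_1 nn_integral_cmult)
  also have "\<dots> \<le> 2 * (\<integral>\<^sup>+x. ennreal (h x) \<partial>lborel)"
    by (intro mult_left_mono nn_integral_mono) (auto intro!: ennreal_leI)
  finally show ?thesis .
qed

lemma ennreal_AM_GM:
  fixes p q m :: ennreal
  assumes "p + q \<le> 2 * m"
  shows "p * q \<le> m\<^sup>2"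
proof (cases "m = \<infinity>")
  case True
  then show ?thesis by (simp add: power2_eq_square)
next
  case False
  then obtain m' where m: "m = ennreal m'" "0 \<le> m'" by (cases m) auto
  have "p + q < \<infinity>" using assms m by (metis ennreal_less_top ennreal_mult_less_top ennreal_numeral infinity_ennreal_def order_le_less_trans zero_le_numeral)
  then obtain p' q' where pq: "p = ennreal p'" "0 \<le> p'" "q = ennreal q'" "0 \<le> q'" by (cases p; cases q) auto
  have "p' + q' \<le> 2 * m'"
  proof -
    have "ennreal (p' + q') \<le> ennreal (2 * m')" using assms m pq by (simp add: ennreal_mult)
    then show ?thesis using m by (subst (asm) ennreal_le_iff) auto
  qed
  then have "(p' + q')\<^sup>2 \<le> (2 * m')\<^sup>2" using pq by (intro power_mono) auto
  moreover have "4 * (p' * q') \<le> (p' + q')\<^sup>2" using zero_le_power2[of "p' - q'"] by (simp add: power2_eq_square algebra_simps)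
  ultimately have "p' * q' \<le> m'\<^sup>2" by (simp add: power_mult_distrib)
  then show ?thesis using m pq by (simp add: ennreal_power flip: ennreal_mult)
qed

text \<open>Divide \<open>u\<close> and \<open>v\<close> by their suprema \<open>a\<close> and
  \<open>b\<close>, and \<open>h\<close> by \<open>sqrt (a * b)\<close>: the pointwise hypothesis is
  preserved and the normalised inequality applies. The arithmetic-geometric mean inequality turns
  its sum into a product, and the factor \<open>a * b\<close> is put back. If a supremum is 0, that
  function vanishes.\<close>

lemma Prekopa_Leindler_real:
  fixes u v h :: "real \<Rightarrow> real"
  assumes [measurable]: "u \<in> borel_measurable borel" "v \<in> borel_measurable borel" "h \<in> borel_measurable borel"
    and u: "\<And>x. 0 \<le> u x" "bdd_above (range u)" and v: "\<And>x. 0 \<le> v x" "bdd_above (range v)"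
    and h: "\<And>x. 0 \<le> h x"
    and uvh: "\<And>x y. u x * v y \<le> (h ((x + y) / 2))\<^sup>2"
  shows "(\<integral>\<^sup>+x. ennreal (u x) \<partial>lborel) * (\<integral>\<^sup>+x. ennreal (v x) \<partial>lborel) \<le> (\<integral>\<^sup>+x. ennreal (h x) \<partial>lborel)\<^sup>2"
proof -
  define a b where "a = (SUP x. u x)" and "b = (SUP x. v x)"
  have ua: "u x \<le> a" and vb: "v x \<le> b" for x
    unfolding a_def b_def using u v by (auto intro!: cSUP_upper)
  have "0 \<le> a" "0 \<le> b" using ua[of 0] vb[of 0] u(1)[of 0] v(1)[of 0] by auto
  show ?thesis
  proof (cases "a = 0 \<or> b = 0")
    case True
    then have "(\<forall>x. u x = 0) \<or> (\<forall>x. v x = 0)" using u v ua vb by (metis antisym)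
    then show ?thesis by auto
  next
    case False
    then have pos: "0 < a" "0 < b" using \<open>0 \<le> a\<close> \<open>0 \<le> b\<close> by auto
    define c where "c = sqrt (a * b)"
    have c: "0 < c" "c\<^sup>2 = a * b" using pos by (auto simp: c_def)
    have scale: "(\<integral>\<^sup>+x. ennreal (f x) \<partial>lborel) = ennreal k * (\<integral>\<^sup>+x. ennreal (f x / k) \<partial>lborel)"
      if [measurable]: "f \<in> borel_measurable borel" and "\<And>x. 0 \<le> f x" "0 < k" for f :: "real \<Rightarrow> real" and k
      using that by (subst nn_integral_cmult[symmetric]) (auto simp flip: ennreal_mult)
    have "(\<integral>\<^sup>+x. ennreal (u x / a) \<partial>lborel) + (\<integral>\<^sup>+x. ennreal (v x / b) \<partial>lborel) \<le> 2 * (\<integral>\<^sup>+x. ennreal (h x / c) \<partial>lborel)"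
    proof (rule Prekopa_Leindler_normalised)
      show "\<exists>x. r < u x / a" if "r < 1" for r
      proof -
        have "r * a < a" using that pos by simp
        then obtain x where "r * a < u x" using less_cSUP_iff[of UNIV u "r * a"] u(2) by (auto simp flip: a_def)
        then show ?thesis using pos by (auto simp: pos_less_divide_eq)
      qed
      show "\<exists>x. r < v x / b" if "r < 1" for r
      proof -
        have "r * b < b" using that pos by simp
        then obtain x where "r * b < v x" using less_cSUP_iff[of UNIV v "r * b"] v(2) by (auto simp flip: b_def)
        then show ?thesis using pos by (auto simp: pos_less_divide_eq)
      qed
      show "u x / a * (v y / b) \<le> (h ((x + y) / 2) / c)\<^sup>2" for x y
        using uvh[of x y] pos by (simp add: power_divide c divide_right_mono)
    qed (use u(1) v(1) h ua vb pos c(1) in \<open>auto simp: divide_le_eq_1\<close>)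
    then have "(\<integral>\<^sup>+x. ennreal (u x / a) \<partial>lborel) * (\<integral>\<^sup>+x. ennreal (v x / b) \<partial>lborel) \<le> (\<integral>\<^sup>+x. ennreal (h x / c) \<partial>lborel)\<^sup>2"
      by (rule ennreal_AM_GM)
    then have "ennreal (c\<^sup>2) * ((\<integral>\<^sup>+x. ennreal (u x / a) \<partial>lborel) * (\<integral>\<^sup>+x. ennreal (v x / b) \<partial>lborel)) \<le> ennreal (c\<^sup>2) * (\<integral>\<^sup>+x. ennreal (h x / c) \<partial>lborel)\<^sup>2"
      by (intro mult_left_mono) auto
    moreover have "ennreal (c\<^sup>2) = ennreal a * ennreal b" "ennreal (c\<^sup>2) = (ennreal c)\<^sup>2"
      using c pos by (simp_all add: ennreal_mult ennreal_power)
    moreover have "(ennreal a * p) * (ennreal b * q) = (ennreal a * ennreal b) * (p * q)" for p q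
      by (simp only: mult_ac)
    moreover have "(ennreal c * p)\<^sup>2 = (ennreal c)\<^sup>2 * p\<^sup>2" for p
      by (rule power_mult_distrib)
    ultimately show ?thesis
      by (simp only: scale[OF assms(1) u(1) pos(1)] scale[OF assms(2) v(1) pos(2)] scale[OF assms(3) h c(1)])
  qed
qed

section \<open>Property (tau) for the Gaussian measure on the line\<close>

lemma sets_gauss1 [simp, measurable_cong]: "sets (gauss1 s) = sets borel"
  by (simp add: gauss1_def)

lemma space_gauss1 [simp]: "space (gauss1 s) = UNIV"
  by (simp add: gauss1_def)

lemma prob_space_gauss1: "0 \<le> s \<Longrightarrow> prob_space (gauss1 s)"
  by (auto simp: gauss1_def intro!: prob_space_return prob_space_normal_density)

text \<open>Apply Prekopa-Leindler to \<open>u\<close> and \<open>v\<close> multiplied by the normal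
  density, with the density itself as \<open>h\<close>. The functions take values in
  \<open>ennreal\<close> because the induction on the dimension applies the property to partial
  integrals, which are not known to be finite.\<close>

lemma gauss1_property_tau:
  fixes u v :: "real \<Rightarrow> ennreal"
  assumes s: "0 \<le> s" "4 * s\<^sup>2 * k \<le> 1"
    and [measurable]: "u \<in> borel_measurable borel" "v \<in> borel_measurable borel"
    and uv: "\<And>x y. u x * v y \<le> ennreal (exp (k * (x - y)\<^sup>2))"
  shows "(\<integral>\<^sup>+x. u x \<partial>gauss1 s) * (\<integral>\<^sup>+x. v x \<partial>gauss1 s) \<le> 1"
proof (cases "s = 0")
  case True
  then show ?thesis using uv[of 0 0] by (simp add: gauss1_def nn_integral_return)
next
  case False
  with s have s0: "0 < s" by simp
  let ?n = "normal_density 0 s"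
  have dens: "(\<integral>\<^sup>+x. w x \<partial>gauss1 s) = (\<integral>\<^sup>+x. ennreal (?n x) * w x \<partial>lborel)"
    if [measurable]: "w \<in> borel_measurable borel" for w :: "real \<Rightarrow> ennreal"
    using False by (simp add: gauss1_def nn_integral_density)
  \<comment> \<open>Prekopa-Leindler is stated for bounded real functions, so \<open>u\<close> and
    \<open>v\<close> are truncated at height \<open>n\<close>; monotone convergence
    (\<open>lim\<close>) removes the truncation.\<close>
  define T where "T w n x = enn2real (min (w x) (of_nat n))" for w :: "real \<Rightarrow> ennreal" and n :: nat and x :: real
  have T: "ennreal (T w n x) = min (w x) (of_nat n)" for w n x
    unfolding T_def by (simp add: ennreal_enn2real min.strict_coboundedI2 of_nat_less_top)
  have Tmeas: "T w n \<in> borel_measurable borel" if [measurable]: "w \<in> borel_measurable borel" for w n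
    unfolding T_def by measurable
  have [measurable]: "T u n \<in> borel_measurable borel" "T v n \<in> borel_measurable borel" for n
    by (rule Tmeas; measurable)+
  have Tpos: "0 \<le> T w n x" for w n x by (simp add: T_def)
  have Tn: "T w n x \<le> real n" for w n x
  proof -
    have "ennreal (T w n x) \<le> ennreal (real n)" by (simp add: T ennreal_of_nat_eq_real_of_nat)
    then show ?thesis by simp
  qed
  have lim: "(\<integral>\<^sup>+x. w x \<partial>gauss1 s) = (SUP n. (\<integral>\<^sup>+x. ennreal (?n x * T w n x) \<partial>lborel))"
    if [measurable]: "w \<in> borel_measurable borel" for w
  proof -
    have "(SUP n. (\<integral>\<^sup>+x. ennreal (?n x * T w n x) \<partial>lborel)) = (SUP n. (\<integral>\<^sup>+x. ennreal (T w n x) \<partial>gauss1 s))"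
      using Tpos Tmeas[OF that] by (simp add: dens ennreal_mult normal_density_nonneg)
    also have "\<dots> = (\<integral>\<^sup>+x. (SUP n. ennreal (T w n x)) \<partial>gauss1 s)"
    proof (rule nn_integral_monotone_convergence_SUP[symmetric])
      show "incseq (\<lambda>n x. ennreal (T w n x))"
        by (auto simp: T incseq_def le_fun_def intro!: min.coboundedI2 of_nat_mono)
      show "(\<lambda>x. ennreal (T w n x)) \<in> borel_measurable (gauss1 s)" for n
        using Tmeas[OF that, of n] by (simp add: measurable_cong_sets[OF sets_gauss1 refl])
    qed
    also have "(\<lambda>x. SUP n. ennreal (T w n x)) = w"
    proof
      fix x
      have "(SUP n. inf (w x) (of_nat n)) = inf (w x) (SUP n. of_nat n)" by (rule inf_SUP[symmetric])
      then show "(SUP n. ennreal (T w n x)) = w x" by (simp add: T inf_min ennreal_SUP_of_nat_eq_top)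
    qed
    finally show ?thesis by simp
  qed
  have PL: "(\<integral>\<^sup>+x. ennreal (?n x * T u n x) \<partial>lborel) * (\<integral>\<^sup>+x. ennreal (?n x * T v m x) \<partial>lborel) \<le> 1" for n m
  proof -
    have nb: "?n x \<le> 1 / sqrt (2 * pi * s\<^sup>2)" for x
      unfolding normal_density_def by (intro mult_right_le_one_le) auto
    have bdd: "bdd_above (range (\<lambda>x. ?n x * T w n x))" for w n
    proof (rule bdd_aboveI2)
      show "?n x * T w n x \<le> 1 / sqrt (2 * pi * s\<^sup>2) * real n" for x
        using nb Tn Tpos by (intro mult_mono) auto
    qed
    have "?n x * T u n x * (?n y * T v m y) \<le> (?n ((x + y) / 2))\<^sup>2" for x y
    proof -
      have "ennreal (T u n x * T v m y) \<le> ennreal (exp (k * (x - y)\<^sup>2))"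
      proof -
        have "ennreal (T u n x * T v m y) = min (u x) (of_nat n) * min (v y) (of_nat m)"
          by (simp add: ennreal_mult Tpos T)
        also have "\<dots> \<le> u x * v y" by (intro mult_mono) auto
        finally show ?thesis using uv[of x y] by (rule order_trans)
      qed
      then have "T u n x * T v m y \<le> exp (k * (x - y)\<^sup>2)" by simp
      also have "k \<le> 1 / (4 * s\<^sup>2)" using s s0 by (simp add: pos_le_divide_eq mult.commute)
      then have "exp (k * (x - y)\<^sup>2) \<le> exp (1 / (4 * s\<^sup>2) * (x - y)\<^sup>2)"
        unfolding exp_le_cancel_iff by (rule mult_right_mono) simp
      finally have "(?n x * ?n y) * (T u n x * T v m y) \<le> (?n x * ?n y) * exp (1 / (4 * s\<^sup>2) * (x - y)\<^sup>2)"
        by (intro mult_left_mono) (auto simp: normal_density_nonneg)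
      \<comment> \<open>The parallelogram identity: the exponents of the densities at
        \<open>x\<close> and \<open>y\<close>, together with \<open>(x - y)^2 / (4 * s^2)\<close>,
        add up to twice the exponent at the midpoint. This is where the bound
        \<open>4 * s^2 * k <= 1\<close> comes from.\<close>
      also have "\<dots> = (?n ((x + y) / 2))\<^sup>2"
      proof -
        define c where "c = 1 / sqrt (2 * pi * s\<^sup>2)"
        have n: "?n z = c * exp (- (z\<^sup>2 / (2 * s\<^sup>2)))" for z by (simp add: normal_density_def c_def)
        have "- (x\<^sup>2 / (2 * s\<^sup>2)) + - (y\<^sup>2 / (2 * s\<^sup>2)) + 1 / (4 * s\<^sup>2) * (x - y)\<^sup>2 = - (((x + y) / 2)\<^sup>2 / (2 * s\<^sup>2)) + - (((x + y) / 2)\<^sup>2 / (2 * s\<^sup>2))"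
        proof -
          define q where "q = 1 / (4 * s\<^sup>2)"
          have q: "z / (2 * s\<^sup>2) = 2 * q * z" for z by (simp add: q_def)
          show ?thesis unfolding q q_def[symmetric] by (simp add: power2_eq_square algebra_simps)
        qed
        then have "exp (- (x\<^sup>2 / (2 * s\<^sup>2))) * exp (- (y\<^sup>2 / (2 * s\<^sup>2))) * exp (1 / (4 * s\<^sup>2) * (x - y)\<^sup>2) = exp (- (((x + y) / 2)\<^sup>2 / (2 * s\<^sup>2))) * exp (- (((x + y) / 2)\<^sup>2 / (2 * s\<^sup>2)))"
          by (simp only: exp_add[symmetric])
        then have "c * c * (exp (- (x\<^sup>2 / (2 * s\<^sup>2))) * exp (- (y\<^sup>2 / (2 * s\<^sup>2))) * exp (1 / (4 * s\<^sup>2) * (x - y)\<^sup>2)) = c * c * (exp (- (((x + y) / 2)\<^sup>2 / (2 * s\<^sup>2))) * exp (- (((x + y) / 2)\<^sup>2 / (2 * s\<^sup>2))))"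
          by (rule arg_cong)
        then show ?thesis
          unfolding n power2_eq_square[of "c * exp (- (((x + y) / 2)\<^sup>2 / (2 * s\<^sup>2)))"] by (simp only: mult_ac)
      qed
      finally show ?thesis by (simp add: mult_ac)
    qed
    then have "(\<integral>\<^sup>+x. ennreal (?n x * T u n x) \<partial>lborel) * (\<integral>\<^sup>+x. ennreal (?n x * T v m x) \<partial>lborel) \<le> (\<integral>\<^sup>+x. ennreal (?n x) \<partial>lborel)\<^sup>2"
      by (intro Prekopa_Leindler_real) (auto simp: bdd Tpos normal_density_nonneg)
    also have "(\<integral>\<^sup>+x. ennreal (?n x) \<partial>lborel) = 1"
      using s0 by (simp add: nn_integral_eq_integral normal_density_nonneg)
    finally show ?thesis by simp
  qed
  \<comment> \<open>The truncation levels of \<open>u\<close> and \<open>v\<close> vary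
    independently, so the product of the suprema is an iterated supremum of the bounded
    products.\<close>
  have "(SUP n. (\<integral>\<^sup>+x. ennreal (?n x * T u n x) \<partial>lborel)) * (SUP m. (\<integral>\<^sup>+x. ennreal (?n x * T v m x) \<partial>lborel)) \<le> 1"
    unfolding SUP_mult_left_ennreal SUP_mult_right_ennreal by (intro SUP_least PL)
  then show ?thesis
    by (simp only: lim[OF assms(3)] lim[OF assms(4)])
qed

section \<open>Gaussian concentration\<close>

lemma space_Rborel [simp]: "space (Rborel d) = Rspace d"
  by (simp add: Rborel_def Rspace_def space_PiM)

lemma sets_gaussian [simp, measurable_cong]: "sets (gaussian d s) = sets (Rborel d)"
  unfolding gaussian_def Rborel_def by (intro sets_PiM_cong) auto

lemma space_gaussian [simp]: "space (gaussian d s) = Rspace d"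
  by (simp add: gaussian_def Rspace_def space_PiM)

lemma prob_space_gaussian: "0 \<le> s \<Longrightarrow> prob_space (gaussian d s)"
  unfolding gaussian_def by (intro prob_space_PiM prob_space_gauss1)

text \<open>Induction on \<open>d\<close>, integrating out the last coordinate. The one-dimensional
  property, applied to the sections of \<open>u\<close> and \<open>v\<close> over fixed
  \<open>x\<close> and \<open>y\<close>, shows that the partial integrals \<open>U\<close> and
  \<open>V\<close> satisfy the hypothesis in dimension \<open>d\<close>.\<close>

lemma gaussian_property_tau:
  assumes s: "0 \<le> s" "4 * s\<^sup>2 * k \<le> 1"
    and "u \<in> borel_measurable (gaussian d s)" "v \<in> borel_measurable (gaussian d s)"
    and "\<And>x y. x \<in> Rspace d \<Longrightarrow> y \<in> Rspace d \<Longrightarrow> u x * v y \<le> ennreal (exp (k * (\<Sum>i<d. (x i - y i)\<^sup>2)))"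
  shows "(\<integral>\<^sup>+x. u x \<partial>gaussian d s) * (\<integral>\<^sup>+x. v x \<partial>gaussian d s) \<le> 1"
  using assms(3-)
proof (induction d arbitrary: u v)
  interpret product_prob_space "\<lambda>_::nat. gauss1 s" UNIV
    by unfold_locales (use prob_space_gauss1[OF s(1)] in \<open>auto simp: prob_space_def finite_measure_def prob_space_axioms_def sigma_finite_measure_def finite_measure_axioms_def\<close>)
  {
    case 0
    then show ?case
      using "0.prems"(3)[of "\<lambda>_. undefined" "\<lambda>_. undefined"]
      by (simp add: gaussian_def nn_integral_empty Rspace_def)
  next
    case (Suc d)
    let ?P = "gaussian d s"
    have ins: "gaussian (Suc d) s = PiM (insert d {..<d}) (\<lambda>_. gauss1 s)"
      by (simp add: gaussian_def lessThan_Suc)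
    have meas[measurable]: "u \<in> borel_measurable (PiM (insert d {..<d}) (\<lambda>_. gauss1 s))"
      "v \<in> borel_measurable (PiM (insert d {..<d}) (\<lambda>_. gauss1 s))"
      using Suc.prems(1,2) unfolding ins by auto
    define U where "U x = (\<integral>\<^sup>+t. u (x(d := t)) \<partial>gauss1 s)" for x
    define V where "V x = (\<integral>\<^sup>+t. v (x(d := t)) \<partial>gauss1 s)" for x
    have "(\<integral>\<^sup>+x. u x \<partial>gaussian (Suc d) s) = (\<integral>\<^sup>+x. U x \<partial>?P)"
      "(\<integral>\<^sup>+x. v x \<partial>gaussian (Suc d) s) = (\<integral>\<^sup>+x. V x \<partial>?P)"
      unfolding ins U_def V_def by (subst product_nn_integral_insert; simp add: gaussian_def)+
    moreover have "(\<integral>\<^sup>+x. U x \<partial>?P) * (\<integral>\<^sup>+x. V x \<partial>?P) \<le> 1"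
    proof (rule Suc.IH)
      show "U \<in> borel_measurable ?P" "V \<in> borel_measurable ?P"
        unfolding U_def V_def gaussian_def by measurable
      fix x y assume xy: "x \<in> Rspace d" "y \<in> Rspace d"
      \<comment> \<open>The cost of the first \<open>d\<close> coordinates. Multiplying the section
        of \<open>v\<close> by \<open>exp (- S)\<close> leaves only the cost of the last coordinate,
        as the one-dimensional property demands.\<close>
      define S where "S = k * (\<Sum>i<d. (x i - y i)\<^sup>2)"
      have upd: "(\<lambda>t. z(d := t)) \<in> borel \<rightarrow>\<^sub>M PiM (insert d {..<d}) (\<lambda>_. gauss1 s)" if "z \<in> Rspace d" for z
      proof -
        have "z \<in> space (PiM {..<d} (\<lambda>_. gauss1 s))" using that by (simp add: Rspace_def space_PiM)
        then show ?thesis by measurable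
      qed
      have m: "(\<lambda>t. u (x(d := t))) \<in> borel_measurable borel" "(\<lambda>t. v (y(d := t))) \<in> borel_measurable borel"
        using measurable_compose[OF upd meas(1)] measurable_compose[OF upd meas(2)] xy by auto
      have "(\<integral>\<^sup>+t. u (x(d := t)) \<partial>gauss1 s) * (\<integral>\<^sup>+t. ennreal (exp (- S)) * v (y(d := t)) \<partial>gauss1 s) \<le> 1"
      proof (rule gauss1_property_tau[OF s])
        fix a b :: real
        have "x(d := a) \<in> Rspace (Suc d)" "y(d := b) \<in> Rspace (Suc d)"
          using xy by (auto simp: Rspace_def PiE_iff extensional_def)
        then have "u (x(d := a)) * v (y(d := b)) \<le> ennreal (exp (k * (\<Sum>i<Suc d. ((x(d := a)) i - (y(d := b)) i)\<^sup>2)))"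
          by (rule Suc.prems(3))
        also have "(\<Sum>i<Suc d. ((x(d := a)) i - (y(d := b)) i)\<^sup>2) = (\<Sum>i<d. (x i - y i)\<^sup>2) + (a - b)\<^sup>2"
          by simp
        also have "exp (k * \<dots>) = exp S * exp (k * (a - b)\<^sup>2)"
          by (simp add: S_def distrib_left exp_add)
        finally have "ennreal (exp (- S)) * (u (x(d := a)) * v (y(d := b))) \<le> ennreal (exp (- S)) * ennreal (exp S * exp (k * (a - b)\<^sup>2))"
          by (rule mult_left_mono) simp
        also have "\<dots> = ennreal (exp (k * (a - b)\<^sup>2))"
          by (simp add: mult.assoc[symmetric] exp_add[symmetric] flip: ennreal_mult)
        finally show "u (x(d := a)) * (ennreal (exp (- S)) * v (y(d := b))) \<le> ennreal (exp (k * (a - b)\<^sup>2))"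
          by (simp add: mult.left_commute)
      qed (use m in measurable)
      also have "(\<integral>\<^sup>+t. ennreal (exp (- S)) * v (y(d := t)) \<partial>gauss1 s) = ennreal (exp (- S)) * V y"
        unfolding V_def using m by (intro nn_integral_cmult) (simp add: measurable_cong_sets[OF sets_gauss1 refl])
      finally have "ennreal (exp S) * (U x * (ennreal (exp (- S)) * V y)) \<le> ennreal (exp S) * 1"
        unfolding U_def by (rule mult_left_mono) simp
      moreover have "ennreal (exp S) * (U x * (ennreal (exp (- S)) * V y)) = (ennreal (exp S) * ennreal (exp (- S))) * (U x * V y)"
        by (simp only: mult_ac)
      moreover have "ennreal (exp S) * ennreal (exp (- S)) = 1"
        by (simp add: exp_add[symmetric] flip: ennreal_mult)
      ultimately show "U x * V y \<le> ennreal (exp (k * (\<Sum>i<d. (x i - y i)\<^sup>2)))"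
        by (simp add: S_def)
    qed
    ultimately show ?case by simp
  }
qed

section \<open>Exponential moments and tails of Lipschitz functions\<close>

lemma edist_nonneg [simp]: "0 \<le> edist d x y"
  by (simp add: edist_def sum_nonneg)

text \<open>Property (tau) for \<open>exp (l * g)\<close> and
  \<open>exp (- l * g - l^2 / (4 * k))\<close>. The pair is admissible because a 1-Lipschitz
  \<open>g\<close> changes by at most the distance \<open>r\<close>, and
  \<open>|l| * r <= k * r^2 + l^2 / (4 * k)\<close> by completing the square.\<close>

lemma gaussian_Laplace_bound:
  assumes s: "0 \<le> s" "4 * s\<^sup>2 * k \<le> 1" "0 < k"
    and g: "g \<in> borel_measurable (Rborel d)"
    and lip: "\<And>x y. x \<in> Rspace d \<Longrightarrow> y \<in> Rspace d \<Longrightarrow> \<bar>g x - g y\<bar> \<le> edist d x y"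
  shows "(\<integral>\<^sup>+x. ennreal (exp (l * g x)) \<partial>gaussian d s) * (\<integral>\<^sup>+x. ennreal (exp (- (l * g x))) \<partial>gaussian d s) \<le> ennreal (exp (l\<^sup>2 / (4 * k)))"
proof -
  have [measurable]: "g \<in> borel_measurable (gaussian d s)" using g by (simp add: measurable_cong_sets[OF sets_gaussian refl])
  let ?c = "exp (- (l\<^sup>2 / (4 * k)))"
  have "(\<integral>\<^sup>+x. ennreal (exp (l * g x)) \<partial>gaussian d s) * (\<integral>\<^sup>+x. ennreal ?c * ennreal (exp (- (l * g x))) \<partial>gaussian d s) \<le> 1"
  proof (rule gaussian_property_tau[OF s(1,2)])
    fix x y assume xy: "x \<in> Rspace d" "y \<in> Rspace d"
    let ?r = "edist d x y"
    have r2: "?r\<^sup>2 = (\<Sum>i<d. (x i - y i)\<^sup>2)" by (simp add: edist_def sum_nonneg)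
    have "l * g x - l * g y \<le> \<bar>l\<bar> * \<bar>g x - g y\<bar>" by (simp add: abs_mult[symmetric] right_diff_distrib)
    also have "\<dots> \<le> \<bar>l\<bar> * ?r" using lip[OF xy] by (intro mult_left_mono) auto
    also have "\<dots> \<le> k * ?r\<^sup>2 + l\<^sup>2 / (4 * k)"
    proof -
      have "0 \<le> k * (?r - \<bar>l\<bar> / (2 * k))\<^sup>2" using s by simp
      also have "\<dots> = k * ?r\<^sup>2 - \<bar>l\<bar> * ?r + l\<^sup>2 / (4 * k)"
        using s(3) by (simp add: power2_diff power_divide field_simps) (simp add: power2_eq_square)
      finally show ?thesis by simp
    qed
    finally have "exp (l * g x + (- (l\<^sup>2 / (4 * k)) + - (l * g y))) \<le> exp (k * ?r\<^sup>2)" by simp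
    then show "ennreal (exp (l * g x)) * (ennreal ?c * ennreal (exp (- (l * g y)))) \<le> ennreal (exp (k * (\<Sum>i<d. (x i - y i)\<^sup>2)))"
      unfolding r2 exp_add by (simp flip: ennreal_mult)
  qed measurable
  then have "(\<integral>\<^sup>+x. ennreal (exp (l * g x)) \<partial>gaussian d s) * (ennreal ?c * (\<integral>\<^sup>+x. ennreal (exp (- (l * g x))) \<partial>gaussian d s)) \<le> 1"
    by (subst (asm) nn_integral_cmult) auto
  then have "ennreal (exp (l\<^sup>2 / (4 * k))) * ((\<integral>\<^sup>+x. ennreal (exp (l * g x)) \<partial>gaussian d s) * (ennreal ?c * (\<integral>\<^sup>+x. ennreal (exp (- (l * g x))) \<partial>gaussian d s))) \<le> ennreal (exp (l\<^sup>2 / (4 * k))) * 1"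
    by (rule mult_left_mono) simp
  moreover have "ennreal (exp (l\<^sup>2 / (4 * k))) * (A * (ennreal ?c * B)) = (ennreal (exp (l\<^sup>2 / (4 * k))) * ennreal ?c) * (A * B)" for A B
    by (simp only: mult_ac)
  moreover have "ennreal (exp (l\<^sup>2 / (4 * k))) * ennreal ?c = 1"
    by (simp add: exp_add[symmetric] flip: ennreal_mult)
  ultimately show ?thesis by simp
qed

text \<open>The product of the exponential moments for \<open>l\<close> and \<open>- l\<close> is
  finite, and the integral of a positive function over a probability space is not 0; hence each
  factor is finite. Integrability of \<open>g\<close> follows from
  \<open>|g| <= exp g + exp (- g)\<close>.\<close>

lemma
  assumes s: "0 \<le> s" "4 * s\<^sup>2 * k \<le> 1" "0 < k"
    and g: "g \<in> borel_measurable (Rborel d)"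
    and lip: "\<And>x y. x \<in> Rspace d \<Longrightarrow> y \<in> Rspace d \<Longrightarrow> \<bar>g x - g y\<bar> \<le> edist d x y"
  shows integrable_exp_Lipschitz_gaussian: "integrable (gaussian d s) (\<lambda>x. exp (l * g x))" (is "?E l")
    and integrable_Lipschitz_gaussian: "integrable (gaussian d s) g"
proof -
  interpret prob_space "gaussian d s" by (rule prob_space_gaussian[OF s(1)])
  have [measurable]: "g \<in> borel_measurable (gaussian d s)" using g by (simp add: measurable_cong_sets[OF sets_gaussian refl])
  have E: "?E l" for l
  proof (rule integrableI_bounded)
    have "(\<integral>\<^sup>+x. ennreal (exp (- (l * g x))) \<partial>gaussian d s) \<noteq> 0"
    proof
      assume "(\<integral>\<^sup>+x. ennreal (exp (- (l * g x))) \<partial>gaussian d s) = 0"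
      then have "AE x in gaussian d s. False" by (subst (asm) nn_integral_0_iff_AE) auto
      then show False by simp
    qed
    then have "(\<integral>\<^sup>+x. ennreal (exp (l * g x)) \<partial>gaussian d s) \<noteq> \<infinity>"
      using gaussian_Laplace_bound[OF assms, of l] by (auto simp: ennreal_top_mult top_unique)
    then show "(\<integral>\<^sup>+x. ennreal (norm (exp (l * g x))) \<partial>gaussian d s) < \<infinity>"
      by (simp add: less_top)
  qed measurable
  then show "?E l" .
  show "integrable (gaussian d s) g"
  proof (rule Bochner_Integration.integrable_bound)
    show "integrable (gaussian d s) (\<lambda>x. exp (1 * g x) + exp (-1 * g x))"
      by (intro Bochner_Integration.integrable_add E)
    have "\<bar>g x\<bar> \<le> exp (g x) + exp (- g x)" for x
      using exp_ge_add_one_self[of "g x"] exp_ge_add_one_self[of "- g x"] exp_gt_zero[of "g x"] exp_gt_zero[of "- g x"]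
      by linarith
    then show "AE x in gaussian d s. norm (g x) \<le> norm (exp (1 * g x) + exp (- 1 * g x))"
      by (intro AE_I2) (simp add: add_nonneg_nonneg)
  qed measurable
qed

text \<open>Chernoff's bound involves only the moment for \<open>l\<close>. Jensen's inequality
  supplies the missing factor: the moment for \<open>- l\<close> is at least
  \<open>exp (- l * m)\<close>, so the Laplace bound for the product controls the centred
  moment.\<close>

lemma gaussian_upper_tail:
  assumes s: "0 \<le> s" "4 * s\<^sup>2 * k \<le> 1" "0 < k"
    and g: "g \<in> borel_measurable (Rborel d)"
    and lip: "\<And>x y. x \<in> Rspace d \<Longrightarrow> y \<in> Rspace d \<Longrightarrow> \<bar>g x - g y\<bar> \<le> edist d x y"
    and e: "0 < e"
  shows "measure (gaussian d s) {x \<in> Rspace d. g x \<ge> (\<integral>y. g y \<partial>gaussian d s) + e} \<le> exp (- (k * e\<^sup>2))"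
proof -
  interpret prob_space "gaussian d s" by (rule prob_space_gaussian[OF s(1)])
  note I = integrable_exp_Lipschitz_gaussian[OF assms(1-5)] integrable_Lipschitz_gaussian[OF assms(1-5)]
  define m where "m = expectation g"
  \<comment> \<open>The minimiser of the final exponent \<open>- l * e + l^2 / (4 * k)\<close>; its
    minimum is \<open>- k * e^2\<close>.\<close>
  define l where "l = 2 * k * e"
  have l: "0 < l" using s e by (simp add: l_def)
  let ?A = "expectation (\<lambda>x. exp (l * g x))" and ?B = "expectation (\<lambda>x. exp (- l * g x))"
  have AB: "?A * ?B \<le> exp (l\<^sup>2 / (4 * k))"
  proof -
    have "ennreal (?A * ?B) = (\<integral>\<^sup>+x. ennreal (exp (l * g x)) \<partial>gaussian d s) * (\<integral>\<^sup>+x. ennreal (exp (- (l * g x))) \<partial>gaussian d s)"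
      using I(1)[of l] I(1)[of "- l"] by (simp add: ennreal_mult nn_integral_eq_integral)
    also have "\<dots> \<le> ennreal (exp (l\<^sup>2 / (4 * k)))" by (rule gaussian_Laplace_bound[OF assms(1-5)])
    finally show ?thesis by simp
  qed
  \<comment> \<open>Jensen's inequality for the exponential, obtained by integrating
    \<open>1 + t <= exp t\<close> with \<open>t = l * m - l * g x\<close>, which has mean 0.\<close>
  have "1 = expectation (\<lambda>x. 1 + (l * m - l * g x))"
    using I(2) prob_space by (simp add: m_def)
  also have "\<dots> \<le> expectation (\<lambda>x. exp (l * m) * exp (- l * g x))"
  proof (rule integral_mono)
    show "1 + (l * m - l * g x) \<le> exp (l * m) * exp (- l * g x)" for x
      using exp_ge_add_one_self[of "l * m - l * g x"] by (simp add: exp_add[symmetric])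
  qed (use I(1)[of "- l"] I(2) in auto)
  also have "\<dots> = exp (l * m) * ?B" by simp
  finally have B: "1 \<le> exp (l * m) * ?B" .
  have "0 \<le> ?A" by simp
  have "prob {x \<in> space (gaussian d s). g x \<ge> m + e} \<le>
      exp (- l * (m + e)) * (\<integral>x\<in>space (gaussian d s). exp (l * g x) \<partial>gaussian d s)"
    by (rule Chernoff_ineq_ge[OF l])
      (use integrable_mult_indicator[OF sets.top I(1)[of l]] sets.top[of "gaussian d s"] in \<open>simp_all add: set_integrable_def\<close>)
  also have "\<dots> = exp (- l * (m + e)) * ?A"
    using I(1) by (subst set_integral_space) auto
  also have "\<dots> \<le> exp (- l * (m + e)) * (?A * (exp (l * m) * ?B))"
    using mult_left_mono[OF B \<open>0 \<le> ?A\<close>] by (intro mult_left_mono) auto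
  also have "\<dots> = exp (- l * e) * (?A * ?B)"
    by (simp add: algebra_simps exp_add exp_diff exp_minus)
  also have "\<dots> \<le> exp (- l * e) * exp (l\<^sup>2 / (4 * k))" by (intro mult_left_mono AB) simp
  also have "\<dots> = exp (- (k * e\<^sup>2))"
    using s(3) by (simp add: exp_add[symmetric] l_def power2_eq_square field_simps)
  finally show ?thesis by (simp add: m_def)
qed

lemma gaussian_concentration:
  assumes s: "0 \<le> s" "4 * s\<^sup>2 * k \<le> 1" "0 < k"
    and g: "g \<in> borel_measurable (Rborel d)"
    and lip: "\<And>x y. x \<in> Rspace d \<Longrightarrow> y \<in> Rspace d \<Longrightarrow> \<bar>g x - g y\<bar> \<le> edist d x y"
    and e: "0 < e"
  shows "measure (gaussian d s) {x \<in> Rspace d. \<bar>g x - (\<integral>y. g y \<partial>gaussian d s)\<bar> > e} \<le> 2 * exp (- (k * e\<^sup>2))"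
proof -
  interpret prob_space "gaussian d s" by (rule prob_space_gaussian[OF s(1)])
  have [measurable]: "g \<in> borel_measurable (gaussian d s)" using g by (simp add: measurable_cong_sets[OF sets_gaussian refl])
  let ?m = "expectation g"
  let ?U = "{x \<in> space (gaussian d s). g x \<ge> ?m + e}" and ?L = "{x \<in> space (gaussian d s). - g x \<ge> expectation (\<lambda>x. - g x) + e}"
  have UL: "?U \<in> events" "?L \<in> events" by measurable
  have "prob {x \<in> space (gaussian d s). \<bar>g x - ?m\<bar> > e} \<le> prob (?U \<union> ?L)"
    by (intro finite_measure_mono sets.Un UL) auto
  also have "\<dots> \<le> prob ?U + prob ?L" by (intro measure_Un_le UL)
  also have "prob ?U \<le> exp (- (k * e\<^sup>2))" using gaussian_upper_tail[OF assms] by simp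
  also have "prob ?L \<le> exp (- (k * e\<^sup>2))"
    using gaussian_upper_tail[of s k "\<lambda>x. - g x" d e] s g lip e by (simp add: abs_minus_commute)
  finally show ?thesis by simp
qed

section \<open>Parametrizations by the unit interval\<close>

text \<open>Base 4 with digits 0 and 1 avoids the ambiguity of binary expansions: a tail sums to at
  most 1/3, so it never carries into the digits before it.\<close>

definition base4 :: "(nat \<Rightarrow> bool) \<Rightarrow> real" where
  "base4 a = (\<Sum>k. of_bool (a k) / 4 ^ Suc k)"

lemma summable_base4: "summable (\<lambda>k. of_bool (a k) / 4 ^ Suc k :: real)"
proof (rule summable_comparison_test')
  show "summable (\<lambda>k. (1/4) * (1/4) ^ k :: real)" by (intro summable_mult summable_geometric) simp
  show "norm (of_bool (a k) / 4 ^ Suc k :: real) \<le> (1/4) * (1/4) ^ k" for k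
    by (simp add: power_divide)
qed

lemma base4_bounds: "0 \<le> base4 a" "base4 a < 1"
proof -
  show "0 \<le> base4 a" unfolding base4_def by (intro suminf_nonneg summable_base4) simp
  have "base4 a \<le> (\<Sum>k. (1/4) * (1/4) ^ k)"
    unfolding base4_def
    by (intro suminf_le summable_base4 summable_mult summable_geometric) (auto simp: power_divide)
  also have "\<dots> = 1/3"
    using sums_unique[OF sums_mult[OF geometric_sums[of "1/4::real"], of "1/4"]] by simp
  finally show "base4 a < 1" by simp
qed

lemma base4_shift: "4 * base4 a = of_bool (a 0) + base4 (\<lambda>k. a (Suc k))"
proof -
  have "base4 a = of_bool (a 0) / 4 + (\<Sum>k. of_bool (a (Suc k)) / 4 ^ Suc (Suc k))"
    unfolding base4_def using suminf_split_head[OF summable_base4[of a]] by simp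
  also have "(\<Sum>k. of_bool (a (Suc k)) / 4 ^ Suc (Suc k)) = (\<Sum>k. (1/4) * (of_bool (a (Suc k)) / 4 ^ Suc k) :: real)"
    by (intro suminf_cong) simp
  also have "\<dots> = (1/4) * base4 (\<lambda>k. a (Suc k))"
    unfolding base4_def by (intro suminf_mult summable_base4)
  finally show ?thesis by simp
qed

text \<open>Multiplication by \<open>4 ^ Suc k\<close> moves digit \<open>k\<close> to the units
  place. All earlier digits contribute multiples of 4 to the integer part, so its parity is that
  digit; the remaining tail lies in [0,1) and disappears under the floor.\<close>

lemma odd_floor_base4: "odd \<lfloor>4 ^ Suc k * base4 a\<rfloor> \<longleftrightarrow> a k"
proof -
  have "\<exists>m::int. 4 ^ Suc k * base4 a = real_of_int (2 * m + of_bool (a k)) + base4 (\<lambda>j. a (Suc k + j))"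
  proof (induction k)
    case 0
    show ?case using base4_shift[of a] by (intro exI[of _ 0]) simp
  next
    case (Suc k)
    then obtain m :: int where m: "4 ^ Suc k * base4 a = real_of_int (2 * m + of_bool (a k)) + base4 (\<lambda>j. a (Suc k + j))" by blast
    have "4 ^ Suc (Suc k) * base4 a = 4 * (4 ^ Suc k * base4 a)" by simp
    also have "\<dots> = real_of_int (2 * (4 * m + 2 * of_bool (a k)) + of_bool (a (Suc k))) + base4 (\<lambda>j. a (Suc (Suc k) + j))"
      unfolding m using base4_shift[of "\<lambda>j. a (Suc k + j)"] by (simp add: distrib_left)
    finally show ?case by blast
  qed
  then obtain m :: int where m: "4 ^ Suc k * base4 a = real_of_int (2 * m + of_bool (a k)) + base4 (\<lambda>j. a (Suc k + j))" by blast
  have "\<lfloor>4 ^ Suc k * base4 a\<rfloor> = 2 * m + of_bool (a k)"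
    unfolding m using base4_bounds[of "\<lambda>j. a (Suc k + j)"] by (intro floor_unique) auto
  then show ?thesis by simp
qed

text \<open>A sequence of reals is coded by the base 4 expansion (with digits 0 and 1 only) of the
  characteristic sequence of the rationals below its entries; the digits are recovered by
  parities, the entries as suprema.\<close>

lemma SUP_rat_less:
  "(SUP j. if of_rat (nat_to_rat_surj j) < x then ereal (of_rat (nat_to_rat_surj j)) else -\<infinity>) = ereal x"
proof (rule antisym)
  show "(SUP j. if of_rat (nat_to_rat_surj j) < x then ereal (of_rat (nat_to_rat_surj j)) else -\<infinity>) \<le> ereal x"
    by (intro SUP_least) simp
  show "ereal x \<le> (SUP j. if of_rat (nat_to_rat_surj j) < x then ereal (of_rat (nat_to_rat_surj j)) else -\<infinity>)"
  proof (rule dense_le)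
    fix z assume z: "z < ereal x"
    obtain y where y: "z < ereal y" "y < x"
      using z by (metis ereal_dense2 less_ereal.simps(1))
    obtain q where q: "y < of_rat q" "of_rat q < x" using of_rat_dense[OF y(2)] by blast
    obtain j where j: "nat_to_rat_surj j = q" using surj_nat_to_rat_surj by (metis surjD)
    have "z \<le> ereal (of_rat q)" using y(1) q(1) by (metis ereal_less_eq(3) less_imp_le less_le_trans)
    then show "z \<le> (SUP j. if of_rat (nat_to_rat_surj j) < x then ereal (of_rat (nat_to_rat_surj j)) else -\<infinity>)"
      using j q(2) by (intro SUP_upper2[of j]) auto
  qed
qed

lemma real_sequences_Borel_retract:
  obtains c :: "(nat \<Rightarrow> real) \<Rightarrow> real" and r :: "real \<Rightarrow> (nat \<Rightarrow> real)"
  where "c \<in> borel_measurable (PiM UNIV (\<lambda>_. borel))" "r \<in> borel \<rightarrow>\<^sub>M PiM UNIV (\<lambda>_. borel)" "\<And>x. r (c x) = x"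
proof
  let ?q = "\<lambda>j. of_rat (nat_to_rat_surj j) :: real"
  define b where "b x k \<longleftrightarrow> ?q (snd (prod_decode k)) < x (fst (prod_decode k))" for x :: "nat \<Rightarrow> real" and k
  \<comment> \<open>For reals that code no sequence the supremum may be infinite;
    \<open>real_of_ereal\<close> then returns 0, which keeps \<open>r\<close> total and
    measurable.\<close>
  define r where "r y i = real_of_ereal (SUP j. if odd \<lfloor>4 ^ Suc (prod_encode (i, j)) * y\<rfloor> then ereal (?q j) else -\<infinity>)"
    for y :: real and i :: nat
  show "(\<lambda>x. base4 (b x)) \<in> borel_measurable (PiM UNIV (\<lambda>_. borel))"
    unfolding base4_def b_def of_bool_def by measurable
  have "(\<lambda>y. r y i) \<in> borel_measurable borel" for i
    unfolding r_def by measurable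
  then show "r \<in> borel \<rightarrow>\<^sub>M PiM UNIV (\<lambda>_. borel)"
    by (intro measurable_PiM_single') auto
  show "r (base4 (b x)) = x" for x
    unfolding r_def odd_floor_base4 b_def by (simp only: prod_encode_inverse fst_conv snd_conv SUP_rat_less real_of_ereal.simps)
qed

text \<open>The quantile function \<open>C.I\<close> of the law of \<open>c\<close> carries Lebesgue
  measure on (0,1) to that law, and the left inverse \<open>r\<close> carries the law back to
  \<open>N\<close>.\<close>

lemma parametrization_of_real_code:
  fixes c :: "'b \<Rightarrow> real"
  assumes "prob_space N" and c: "c \<in> borel_measurable N" and r: "r \<in> borel \<rightarrow>\<^sub>M N"
    and rc: "\<And>x. x \<in> space N \<Longrightarrow> r (c x) = x"
  shows "\<exists>\<phi>. parametrization N \<phi>"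
proof -
  interpret prob_space N by fact
  interpret C: cdf_distribution "distr N borel c"
    unfolding cdf_distribution_def by (rule real_distribution_distr[OF c])
  let ?\<Omega> = "restrict_space lborel {0<..<1::real}"
  define \<phi>0 where "\<phi>0 = r \<circ> C.I"
  have I: "C.I \<in> borel_measurable ?\<Omega>"
    using C.measurable_CI by (simp cong: measurable_cong_sets add: sets_restrict_space)
  have \<phi>0: "\<phi>0 \<in> ?\<Omega> \<rightarrow>\<^sub>M N" unfolding \<phi>0_def using I r by (rule measurable_comp)
  have "distr ?\<Omega> N \<phi>0 = distr (distr ?\<Omega> borel C.I) N r"
    unfolding \<phi>0_def using I r by (simp add: distr_distr)
  also have "\<dots> = distr N N (r \<circ> c)"
    unfolding C.distr_I_eq_M using c r by (simp add: distr_distr)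
  also have "\<dots> = distr N N (\<lambda>x. x)"
    by (intro distr_cong) (auto simp: rc)
  finally have distr: "distr ?\<Omega> N \<phi>0 = N" by simp
  obtain p where p: "p \<in> space N" using not_empty by blast
  \<comment> \<open>The quantile function lives on the open interval. A fixed point \<open>p\<close>
    of the space serves as value elsewhere, so that the parametrization takes values in the space at
    the endpoints too; they form a null set.\<close>
  define \<phi> where "\<phi> t = (if t \<in> {0<..<1} then \<phi>0 t else p)" for t
  have \<phi>: "\<phi> \<in> borel \<rightarrow>\<^sub>M N"
    using \<phi>0 p unfolding \<phi>_def by (subst (asm) measurable_restrict_space_iff[of _ _ p]) auto
  have "parametrization N \<phi>"
    unfolding parametrization_def
  proof safe
    show "\<phi> \<in> unit_lebesgue \<rightarrow>\<^sub>M N"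
      unfolding unit_lebesgue_def using \<phi> by (intro measurable_restrict_space1 measurable_completion) simp
    fix A assume A: "A \<in> sets N"
    let ?B = "\<phi> -` A"
    have B: "?B \<in> sets borel" using measurable_sets[OF \<phi> A] by simp
    have "emeasure N A = emeasure ?\<Omega> (\<phi>0 -` A \<inter> space ?\<Omega>)"
      using emeasure_distr[OF \<phi>0 A] distr by simp
    also have "\<phi>0 -` A \<inter> space ?\<Omega> = ?B \<inter> {0<..<1}"
      by (auto simp: \<phi>_def space_restrict_space)
    also have "emeasure ?\<Omega> \<dots> = emeasure lborel (?B \<inter> {0<..<1})"
      by (rule emeasure_restrict_space) auto
    also have "\<dots> = emeasure lborel (?B \<inter> {0..1})"
    proof (rule emeasure_eq_AE)
      show "AE x in lborel. (x \<in> ?B \<inter> {0<..<1}) = (x \<in> ?B \<inter> {0..1})"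
        using AE_lborel_singleton[of 0] AE_lborel_singleton[of 1] by eventually_elim auto
    qed (use B in auto)
    also have "\<dots> = emeasure lebesgue (?B \<inter> {0..1})" using B by (simp add: emeasure_completion)
    also have "\<dots> = emeasure unit_lebesgue (?B \<inter> space unit_lebesgue)"
      unfolding unit_lebesgue_def by (subst emeasure_restrict_space) (auto simp: space_restrict_space)
    finally show "measure N A = measure unit_lebesgue (?B \<inter> space unit_lebesgue)"
      by (simp add: measure_def)
  qed
  then show ?thesis by blast
qed

text \<open>Used to derive parametrizations of both mm-spaces from one joint parametrization, so
  that they are coupled.\<close>

lemma parametrization_comp:
  assumes \<phi>: "parametrization N \<phi>" and f: "f \<in> N \<rightarrow>\<^sub>M L" and L: "L = distr N L f"
  shows "parametrization L (\<lambda>t. f (\<phi> t))"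
  unfolding parametrization_def
proof safe
  have m: "\<phi> \<in> unit_lebesgue \<rightarrow>\<^sub>M N" using \<phi> by (simp add: parametrization_def)
  then show "(\<lambda>t. f (\<phi> t)) \<in> unit_lebesgue \<rightarrow>\<^sub>M L" using f by (rule measurable_compose)
  fix A assume A: "A \<in> sets L"
  have "measure L A = measure N (f -` A \<inter> space N)"
    using A f by (subst L) (simp add: measure_distr)
  also have "\<dots> = measure unit_lebesgue (\<phi> -` (f -` A \<inter> space N) \<inter> space unit_lebesgue)"
    using \<phi> f A by (auto simp: parametrization_def)
  also have "\<phi> -` (f -` A \<inter> space N) \<inter> space unit_lebesgue = (\<lambda>t. f (\<phi> t)) -` A \<inter> space unit_lebesgue"
    using measurable_space[OF m] by auto
  finally show "measure L A = measure unit_lebesgue ((\<lambda>t. f (\<phi> t)) -` A \<inter> space unit_lebesgue)" .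
qed

section \<open>Euclidean spaces of extensional functions\<close>

lemma edist_L2_set: "edist d x y = L2_set (\<lambda>i. x i - y i) {..<d}"
  by (simp add: edist_def L2_set_def)

lemma edist_self [simp]: "edist d x x = 0"
  by (simp add: edist_def)

lemma edist_commute: "edist d x y = edist d y x"
  by (simp add: edist_def power2_commute)

lemma edist_triangle: "edist d x z \<le> edist d x y + edist d y z"
  using L2_set_triangle_ineq[of "\<lambda>i. x i - y i" "\<lambda>i. y i - z i" "{..<d}"] by (simp add: edist_L2_set)

lemma edist_restrict [simp]: "edist d (restrict x {..<d}) y = edist d x y" "edist d x (restrict y {..<d}) = edist d x y"
  by (simp_all add: edist_def)

lemma restrict_in_Rspace [simp]: "restrict x {..<d} \<in> Rspace d"
  by (simp add: Rspace_def)

lemma restrict_Rspace: "x \<in> Rspace d \<Longrightarrow> restrict x {..<d} = x"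
  by (auto simp: Rspace_def PiE_restrict)

text \<open>Coordinates beyond the dimension are constantly \<open>undefined\<close> on
  \<open>Rspace d\<close>. Having all coordinates at hand makes the inclusion into the space of all
  real sequences measurable, where Borel sets of the product topology can be used.\<close>

lemma measurable_component_Rborel [measurable]: "(\<lambda>x. x i) \<in> borel_measurable (Rborel d)"
proof (cases "i < d")
  case True
  then have "(\<lambda>x. x i) \<in> Rborel d \<rightarrow>\<^sub>M lborel"
    unfolding Rborel_def by (intro measurable_component_singleton) simp
  then show ?thesis by simp
next
  case False
  then have "x i = undefined" if "x \<in> space (Rborel d)" for x
    using that PiE_arb[of x "{..<d}" "\<lambda>_. UNIV" i] by (simp add: Rspace_def)
  then have "(\<lambda>x. x i) \<in> borel_measurable (Rborel d) \<longleftrightarrow> (\<lambda>_. undefined :: real) \<in> borel_measurable (Rborel d)"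
    by (rule measurable_cong)
  then show ?thesis by simp
qed

lemma measurable_into_Rborel:
  assumes "\<And>i. i < d \<Longrightarrow> (\<lambda>x. f x i) \<in> borel_measurable M" "\<And>x. x \<in> space M \<Longrightarrow> f x \<in> Rspace d"
  shows "f \<in> M \<rightarrow>\<^sub>M Rborel d"
  unfolding Rborel_def using assms
  by (intro measurable_PiM_single') (auto simp: Rspace_def PiE_iff cong: measurable_cong_sets)

lemma measurable_Rborel_PiM: "(\<lambda>x. x) \<in> Rborel d \<rightarrow>\<^sub>M PiM UNIV (\<lambda>_. borel)"
  by (intro measurable_PiM_single') auto

lemma measurable_Rborel_borel: "(\<lambda>x. x) \<in> Rborel d \<rightarrow>\<^sub>M borel"
  using measurable_Rborel_PiM[of d] by (simp add: measurable_cong_sets[OF refl sets_PiM_equal_borel])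

text \<open>Composed with restriction to the first \<open>d\<close> coordinates, \<open>g\<close> is
  continuous on all real sequences, since \<open>edist d\<close> depends on finitely many
  coordinates. Its Borel measurability is then pulled back along the inclusion of
  \<open>Rspace d\<close>.\<close>

lemma Lipschitz_measurable:
  assumes lip: "\<And>x y. x \<in> Rspace d \<Longrightarrow> y \<in> Rspace d \<Longrightarrow> \<bar>g x - g y\<bar> \<le> edist d x y"
  shows "g \<in> borel_measurable (Rborel d)"
proof -
  let ?g = "\<lambda>w. g (restrict w {..<d})"
  have "continuous_on UNIV ?g"
    unfolding continuous_on_def
  proof
    fix w0 :: "nat \<Rightarrow> real"
    have "continuous_on UNIV (\<lambda>w :: nat \<Rightarrow> real. edist d w w0)"
      unfolding edist_def by (intro continuous_intros continuous_on_product_coordinates)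
    then have "((\<lambda>w. edist d w w0) \<longlongrightarrow> edist d w0 w0) (at w0 within UNIV)"
      unfolding continuous_on_def by blast
    then have "((\<lambda>w. edist d w w0) \<longlongrightarrow> 0) (at w0)" by simp
    then have "((\<lambda>w. ?g w - ?g w0) \<longlongrightarrow> 0) (at w0)"
      by (rule Lim_null_comparison[rotated]) (use lip[of "restrict w {..<d}" "restrict w0 {..<d}" for w] in simp)
    then show "(?g \<longlongrightarrow> ?g w0) (at w0 within UNIV)" by (simp add: LIM_zero_iff)
  qed
  then have "?g \<in> borel_measurable borel" by (rule borel_measurable_continuous_onI)
  then have "?g \<in> borel_measurable (Rborel d)"
    using measurable_Rborel_borel by (rule measurable_compose[rotated])
  then show ?thesis
    by (rule measurable_cong[THEN iffD1, rotated]) (simp add: restrict_Rspace)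
qed

lemma topspace_Rtop [simp]: "topspace (Rtop d) = Rspace d"
  by (simp add: Rtop_def Rspace_def)

lemma compactin_Rtop_measurable:
  assumes S: "compactin (Rtop d) S"
  shows "S \<in> sets (Rborel d)"
proof -
  have "Hausdorff_space (Rtop d)" unfolding Rtop_def by (simp add: Hausdorff_space_product_topology)
  then have cl: "closedin (Rtop d) S" using S by (rule compactin_imp_closedin)
  have "continuous_map euclidean (Rtop d) (\<lambda>w. restrict w {..<d})"
    unfolding Rtop_def
    by (auto simp: continuous_map_componentwise intro: continuous_on_product_coordinates)
  from closedin_continuous_map_preimage[OF this cl]
  have "closed {w. restrict w {..<d} \<in> S}" by simp
  then have "{w. restrict w {..<d} \<in> S} \<in> sets borel" by (rule borel_closed)
  from measurable_sets[OF measurable_Rborel_borel this]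
  have "{w. restrict w {..<d} \<in> S} \<inter> Rspace d \<in> sets (Rborel d)" by simp
  moreover have "{w. restrict w {..<d} \<in> S} \<inter> Rspace d = S"
    using compactin_subset_topspace[OF S] by (auto simp: restrict_Rspace)
  ultimately show ?thesis by simp
qed

text \<open>The \<open>LEAST\<close> in the definition of the covering number is meaningful only if
  some finite cover exists. Compactness provides one, and so the least cardinality is
  attained.\<close>

lemma compactin_Rtop_covering_number:
  assumes S: "compactin (Rtop d) S" and e: "0 < e"
  obtains C where "finite C" "card C = covering_number d S e" "C \<subseteq> Rspace d"
    "S \<subseteq> (\<Union>c\<in>C. {x \<in> Rspace d. edist d c x < e})"
proof -
  let ?B = "\<lambda>c. {x \<in> Rspace d. edist d c x < e}"
  have op: "openin (Rtop d) (?B c)" for c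
  proof -
    have "continuous_map (Rtop d) euclideanreal (edist d c)"
      unfolding edist_def Rtop_def
      by (intro continuous_map_sqrt continuous_map_sum continuous_map_real_pow continuous_map_diff continuous_map_product_projection) auto
    then have "openin (Rtop d) {x \<in> topspace (Rtop d). edist d c x \<in> {..<e}}"
      by (rule openin_continuous_map_preimage) simp
    then show ?thesis by simp
  qed
  have "\<exists>\<F>. finite \<F> \<and> \<F> \<subseteq> ?B ` S \<and> S \<subseteq> \<Union>\<F>"
  proof (rule compactinD[OF S])
    show "\<And>U. U \<in> ?B ` S \<Longrightarrow> openin (Rtop d) U" using op by blast
    show "S \<subseteq> \<Union> (?B ` S)"
    proof
      fix x assume "x \<in> S"
      moreover from this have "x \<in> ?B x" using compactin_subset_topspace[OF S] e by auto
      ultimately show "x \<in> \<Union> (?B ` S)" by blast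
    qed
  qed
  then obtain \<F> where F: "finite \<F>" "\<F> \<subseteq> ?B ` S" "S \<subseteq> \<Union>\<F>" by blast
  from finite_subset_image[OF F(1,2)] obtain C where C: "C \<subseteq> S" "finite C" "\<F> = ?B ` C" by blast
  let ?P = "\<lambda>n. \<exists>C. finite C \<and> card C = n \<and> C \<subseteq> Rspace d \<and> S \<subseteq> (\<Union>c\<in>C. ?B c)"
  have "?P (card C)"
    using C F compactin_subset_topspace[OF S] by (intro exI[of _ C]) auto
  then have "?P (covering_number d S e)" unfolding covering_number_def by (rule LeastI)
  then show ?thesis using that by blast
qed

text \<open>A pair of vectors is stored in a single real sequence, which has a real code; this gives
  the coding and its left inverse that a parametrization by quantiles requires.\<close>

lemma parametrization_exists_pair:
  assumes N: "prob_space N" "sets N = sets (restrict_space (Rborel d) S \<Otimes>\<^sub>M Rborel d)"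
    and S: "S \<in> sets (Rborel d)" "S \<noteq> {}"
  shows "\<exists>\<phi>. parametrization N \<phi>"
proof -
  obtain c r where c: "c \<in> borel_measurable (PiM UNIV (\<lambda>_::nat. borel :: real measure))"
    and r: "r \<in> (borel :: real measure) \<rightarrow>\<^sub>M PiM UNIV (\<lambda>_::nat. borel)" and rc: "\<And>x. r (c x) = x"
    using real_sequences_Borel_retract by blast
  obtain x0 where x0: "x0 \<in> S" using S by auto
  have Ssub: "S \<subseteq> Rspace d" using sets.sets_into_space[OF S(1)] by simp
  let ?R = "restrict_space (Rborel d) S"
  have spR: "space ?R = S" using Ssub by (auto simp: space_restrict_space)
  \<comment> \<open>The coordinates of \<open>x\<close> go to the even positions and those of
    \<open>z\<close> to the odd ones.\<close>
  define F where "F p n = (if even n then fst p (n div 2) else snd p (n div 2))" for p :: "(nat \<Rightarrow> real) \<times> (nat \<Rightarrow> real)" and n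
  have F: "F \<in> ?R \<Otimes>\<^sub>M Rborel d \<rightarrow>\<^sub>M PiM UNIV (\<lambda>_. borel)"
  proof (rule measurable_PiM_single')
    have "(\<lambda>p. fst p i) \<in> borel_measurable (?R \<Otimes>\<^sub>M Rborel d)" for i
      by (rule measurable_compose[OF measurable_fst]) (intro measurable_restrict_space1 measurable_component_Rborel)
    moreover have "(\<lambda>p. snd p i) \<in> borel_measurable (?R \<Otimes>\<^sub>M Rborel d)" for i
      by measurable
    ultimately show "(\<lambda>p. F p n) \<in> borel_measurable (?R \<Otimes>\<^sub>M Rborel d)" for n
      unfolding F_def by (cases "even n") auto
  qed auto
  define P where "P k w = (\<lambda>i\<in>{..<d}. w (2 * i + k))" for k :: nat and w :: "nat \<Rightarrow> real"
  have P: "P k \<in> PiM UNIV (\<lambda>_. borel) \<rightarrow>\<^sub>M Rborel d" for k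
    by (rule measurable_into_Rborel) (auto simp: P_def)
  \<comment> \<open>A decoded first component outside \<open>S\<close> is replaced by
    \<open>x0\<close>, so that the inverse maps into \<open>S\<close> everywhere.\<close>
  define G where "G w = (if P 0 w \<in> S then P 0 w else x0, P 1 w)" for w
  have G: "G \<in> PiM UNIV (\<lambda>_. borel) \<rightarrow>\<^sub>M ?R \<Otimes>\<^sub>M Rborel d"
    unfolding G_def
  proof (rule measurable_Pair)
    have "(\<lambda>w. if P 0 w \<in> S then P 0 w else x0) \<in> PiM UNIV (\<lambda>_. borel) \<rightarrow>\<^sub>M Rborel d"
    proof (rule measurable_If)
      show "{x \<in> space (PiM UNIV (\<lambda>_. borel)). P 0 x \<in> S} \<in> sets (PiM UNIV (\<lambda>_. borel))"
        using P S(1) by measurable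
      show "(\<lambda>x. x0) \<in> PiM UNIV (\<lambda>_. borel) \<rightarrow>\<^sub>M Rborel d" using x0 Ssub by (intro measurable_const) auto
    qed (rule P)
    then show "(\<lambda>w. if P 0 w \<in> S then P 0 w else x0) \<in> PiM UNIV (\<lambda>_. borel) \<rightarrow>\<^sub>M ?R"
      using x0 by (intro measurable_restrict_space2) auto
  qed (rule P)
  have GF: "G (F p) = p" if pS: "p \<in> S \<times> Rspace d" for p
  proof -
    obtain x z where p: "p = (x, z)" "x \<in> S" "z \<in> Rspace d" using pS by (rule SigmaE)
    have "P 0 (F p) = restrict x {..<d}" "P 1 (F p) = restrict z {..<d}"
      by (auto simp: P_def F_def p restrict_def)
    moreover have "x \<in> Rspace d" using p Ssub by auto
    ultimately show ?thesis using p by (simp add: G_def restrict_Rspace)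
  qed
  have spN: "space N = S \<times> Rspace d"
    using sets_eq_imp_space_eq[OF N(2)] by (simp add: space_pair_measure spR)
  show ?thesis
  proof (rule parametrization_of_real_code[OF N(1)])
    show "(\<lambda>p. c (F p)) \<in> borel_measurable N"
      using measurable_compose[OF F c] by (simp add: measurable_cong_sets[OF N(2) refl])
    show "(\<lambda>y. G (r y)) \<in> borel \<rightarrow>\<^sub>M N"
      using measurable_compose[OF r G] by (simp add: measurable_cong_sets[OF refl N(2)])
    show "G (r (c (F p))) = p" if "p \<in> space N" for p
      using that by (simp add: rc GF spN)
  qed
qed

section \<open>Noise that does not shorten distances\<close>

text \<open>McShane's infimum formula is exactly 1-Lipschitz, as an infimum of 1-Lipschitz
  functions; the defect \<open>e\<close> in the data costs only accuracy at the points
  \<open>p i\<close>. Values are attached to indices because one point \<open>x + z\<close> may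
  arise from several pairs, with different values \<open>f x\<close>.\<close>

lemma McShane_extension:
  fixes F :: "'i \<Rightarrow> real"
  assumes F: "\<And>i j. i \<in> I \<Longrightarrow> j \<in> I \<Longrightarrow> \<bar>F i - F j\<bar> \<le> edist d (p i) (p j) + e"
  obtains g where "\<And>x y. \<bar>g x - g y\<bar> \<le> edist d x y" "\<And>i. i \<in> I \<Longrightarrow> \<bar>g (p i) - F i\<bar> \<le> e"
proof (cases "I = {}")
  case True
  then show ?thesis using that[of "\<lambda>_. 0"] by simp
next
  case False
  then obtain i0 where i0: "i0 \<in> I" by blast
  define g where "g x = (INF i\<in>I. F i + edist d x (p i))" for x
  have bdd: "bdd_below ((\<lambda>i. F i + edist d x (p i)) ` I)" for x
  proof (rule bdd_belowI2)
    fix i assume "i \<in> I"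
    then show "F i0 - edist d (p i0) x - e \<le> F i + edist d x (p i)"
      using F[OF i0, of i] edist_triangle[of d "p i0" "p i" x] by linarith
  qed
  have g_le: "g x \<le> F i + edist d x (p i)" if "i \<in> I" for x i
    unfolding g_def by (rule cINF_lower[OF bdd that])
  have g_ge: "b \<le> g x" if "\<And>i. i \<in> I \<Longrightarrow> b \<le> F i + edist d x (p i)" for x b
    unfolding g_def using False that by (rule cINF_greatest)
  have g1: "g x - edist d x y \<le> g y" for x y
  proof (rule g_ge)
    fix i assume "i \<in> I"
    then show "g x - edist d x y \<le> F i + edist d y (p i)"
      using g_le[of i x] edist_triangle[of d x "p i" y] by linarith
  qed
  have "\<bar>g x - g y\<bar> \<le> edist d x y" for x y
    using g1[of x y] g1[of y x] edist_commute[of d x y] by linarith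
  moreover have "\<bar>g (p i) - F i\<bar> \<le> e" if i: "i \<in> I" for i
  proof -
    have "F i - e \<le> g (p i)"
      by (rule g_ge) (use F[OF i] in \<open>force simp: abs_le_iff\<close>)
    moreover have "g (p i) \<le> F i" using g_le[OF i, of "p i"] by simp
    ultimately show ?thesis using F[OF i i] by simp
  qed
  ultimately show ?thesis by (rule that)
qed

lemma inner_le_L2_set: "\<bar>\<Sum>i\<in>A. f i * g i\<bar> \<le> L2_set f A * L2_set g A"
proof -
  have "\<bar>\<Sum>i\<in>A. f i * g i\<bar> \<le> (\<Sum>i\<in>A. \<bar>f i\<bar> * \<bar>g i\<bar>)"
    using sum_abs[of "\<lambda>i. f i * g i" A] by (simp add: abs_mult)
  also have "\<dots> \<le> L2_set f A * L2_set g A" by (rule L2_set_mult_ineq)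
  finally show ?thesis .
qed

lemma L2_set_diff_le: "L2_set (\<lambda>i. f i - g i) A \<le> L2_set f A + L2_set (g :: _ \<Rightarrow> real) A"
  using L2_set_triangle_ineq[of f "\<lambda>i. - g i" A] by (simp add: L2_set_def)

text \<open>Here \<open>a\<close> is a difference of points of the manifold, \<open>b\<close> the
  difference of nearby centres and \<open>w\<close> a difference of noise vectors. If
  \<open>|a| > e\<close>, the hypotheses give \<open><a, w> >= - e * |a|\<close>, hence
  \<open><a, a + w> >= |a| * (|a| - e)\<close>, and Cauchy-Schwarz finishes.\<close>

lemma norm_add_almost_orthogonal:
  fixes a b w :: "nat \<Rightarrow> real"
  assumes ip: "\<bar>\<Sum>i<d. b i * w i\<bar> \<le> e / 2 * L2_set b {..<d}"
    and w: "L2_set w {..<d} \<le> 2 * K"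
    and r: "L2_set (\<lambda>i. a i - b i) {..<d} \<le> 2 * h"
    and h: "h * (e + 4 * K) \<le> e\<^sup>2 / 2" and pos: "0 < e" "0 \<le> K" "0 \<le> h"
  shows "L2_set a {..<d} - e \<le> L2_set (\<lambda>i. a i + w i) {..<d}"
proof (cases "L2_set a {..<d} \<le> e")
  case True
  then show ?thesis using L2_set_nonneg[of "\<lambda>i. a i + w i" "{..<d}"] by linarith
next
  case False
  define n where "n = L2_set a {..<d}"
  have n: "e < n" using False by (simp add: n_def)
  have nb: "L2_set b {..<d} \<le> n + 2 * h"
    using L2_set_diff_le[of a "\<lambda>i. a i - b i" "{..<d}"] r by (simp add: n_def)
  have "(\<Sum>i<d. a i * w i) = (\<Sum>i<d. b i * w i) + (\<Sum>i<d. (a i - b i) * w i)"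
    by (simp add: sum.distrib[symmetric] algebra_simps)
  moreover have "e / 2 * L2_set b {..<d} \<le> e / 2 * (n + 2 * h)"
    using nb pos by (intro mult_left_mono) auto
  moreover have "\<bar>\<Sum>i<d. (a i - b i) * w i\<bar> \<le> 2 * h * (2 * K)"
    using inner_le_L2_set[of "\<lambda>i. a i - b i" w "{..<d}"] mult_mono[OF r w] pos by simp
  ultimately have "(\<Sum>i<d. a i * w i) \<ge> - (e / 2 * (n + 2 * h)) - 4 * h * K"
    using ip by linarith
  \<comment> \<open>Replacing \<open>b\<close> by \<open>a\<close> costs
    \<open>h * (e + 4 * K)\<close>. The hypothesis on \<open>h\<close> bounds this by
    \<open>e^2 / 2\<close>, which is at most \<open>e * n / 2\<close> since
    \<open>n > e\<close>.\<close>
  also have "- (e / 2 * (n + 2 * h)) - 4 * h * K = - (e / 2 * n) - h * (e + 4 * K)"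
    by (simp add: algebra_simps)
  also have "\<dots> \<ge> - (e / 2 * n) - e\<^sup>2 / 2" using h by simp
  also have "e\<^sup>2 / 2 \<le> e / 2 * n" using n pos by (simp add: power2_eq_square)
  then have "- (e / 2 * n) - e\<^sup>2 / 2 \<ge> - (e * n)" by simp
  finally have aw: "- (e * n) \<le> (\<Sum>i<d. a i * w i)" by simp
  have "n\<^sup>2 = (\<Sum>i<d. a i * a i)" by (simp add: n_def L2_set_def sum_nonneg power2_eq_square)
  then have "n * (n - e) \<le> (\<Sum>i<d. a i * (a i + w i))"
    using aw by (simp add: algebra_simps sum.distrib power2_eq_square)
  also have "\<dots> \<le> n * L2_set (\<lambda>i. a i + w i) {..<d}"
    using inner_le_L2_set[of a "\<lambda>i. a i + w i" "{..<d}"] by (simp add: n_def)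
  finally show ?thesis using n pos by (simp add: n_def)
qed

definition padd :: "nat \<Rightarrow> (nat \<Rightarrow> real) \<Rightarrow> (nat \<Rightarrow> real) \<Rightarrow> nat \<Rightarrow> real" where
  "padd d x z = (\<lambda>i\<in>{..<d}. x i + z i)"

lemma padd_in_Rspace [simp]: "padd d x z \<in> Rspace d"
  by (simp add: padd_def)

lemma edist_padd [simp]:
  "edist d (padd d x z) (padd d x z') = edist d z z'" "edist d (padd d x z) (padd d y z) = edist d x y"
  by (simp_all add: edist_def padd_def)

lemma measurable_padd [measurable]:
  assumes [measurable]: "f \<in> M \<rightarrow>\<^sub>M Rborel d" "g \<in> M \<rightarrow>\<^sub>M Rborel d"
  shows "(\<lambda>x. padd d (f x) (g x)) \<in> M \<rightarrow>\<^sub>M Rborel d"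
  by (rule measurable_into_Rborel) (simp_all add: padd_def)

lemma nn_integral_square_gauss1:
  assumes "0 \<le> s"
  shows "(\<integral>\<^sup>+t. ennreal (t\<^sup>2) \<partial>gauss1 s) = ennreal (s\<^sup>2)"
proof (cases "s = 0")
  case True
  then show ?thesis by (simp add: gauss1_def nn_integral_return)
next
  case False
  with assms have s: "0 < s" by simp
  have "(\<integral>\<^sup>+t. ennreal (t\<^sup>2) \<partial>gauss1 s) = (\<integral>\<^sup>+t. ennreal (normal_density 0 s t * t\<^sup>2) \<partial>lborel)"
    using False by (simp add: gauss1_def nn_integral_density ennreal_mult normal_density_nonneg)
  also have "\<dots> = ennreal (s\<^sup>2)"
  proof -
    have "fact (2 * 1) / ((2 / s\<^sup>2) ^ 1 * fact 1) = s\<^sup>2" by (simp add: fact_numeral)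
    then have "has_bochner_integral lborel (\<lambda>t. normal_density 0 s t * t\<^sup>2) (s\<^sup>2)"
      using normal_moment_even[OF s, of 0 1] by simp
    then show ?thesis
      by (subst nn_integral_eq_integral) (simp_all add: has_bochner_integral_iff normal_density_nonneg)
  qed
  finally show ?thesis .
qed

text \<open>Markov's inequality for the squared norm, whose expectation is
  \<open>d * s^2\<close>.\<close>

lemma gaussian_norm_tail:
  assumes s: "0 \<le> s" and K: "0 < K"
  shows "measure (gaussian d s) {z \<in> Rspace d. L2_set z {..<d} > K} \<le> real d * s\<^sup>2 / K\<^sup>2"
proof -
  interpret prob_space "gaussian d s" by (rule prob_space_gaussian[OF s])
  have [measurable]: "(\<lambda>x. x i) \<in> borel_measurable (gaussian d s)" for i
    by (simp add: measurable_cong_sets[OF sets_gaussian refl])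
  have comp: "(\<integral>\<^sup>+z. ennreal ((z i)\<^sup>2) \<partial>gaussian d s) = ennreal (s\<^sup>2)" if i: "i < d" for i
  proof -
    have "(\<integral>\<^sup>+z. ennreal ((z i)\<^sup>2) \<partial>gaussian d s) = (\<integral>\<^sup>+t. ennreal (t\<^sup>2) \<partial>distr (gaussian d s) (gauss1 s) (\<lambda>z. z i))"
    proof (rule nn_integral_distr[symmetric])
      show "(\<lambda>z. z i) \<in> gaussian d s \<rightarrow>\<^sub>M gauss1 s"
        by (simp add: measurable_cong_sets[OF refl sets_gauss1])
      show "(\<lambda>t. ennreal (t\<^sup>2)) \<in> borel_measurable (distr (gaussian d s) (gauss1 s) (\<lambda>z. z i))"
        unfolding measurable_distr_eq1 measurable_cong_sets[OF sets_gauss1 refl] by measurable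
    qed
    also have "distr (gaussian d s) (gauss1 s) (\<lambda>z. z i) = gauss1 s"
      unfolding gaussian_def using i by (intro distr_PiM_component prob_space_gauss1 s) auto
    finally show ?thesis by (simp add: nn_integral_square_gauss1[OF s])
  qed
  have "(\<integral>\<^sup>+z. ennreal ((L2_set z {..<d})\<^sup>2) \<partial>gaussian d s) = (\<integral>\<^sup>+z. (\<Sum>i<d. ennreal ((z i)\<^sup>2)) \<partial>gaussian d s)"
    by (simp add: L2_set_def sum_nonneg)
  also have "\<dots> = ennreal (real d * s\<^sup>2)"
    by (subst nn_integral_sum) (simp_all add: comp ennreal_mult ennreal_of_nat_eq_real_of_nat)
  finally have I: "(\<integral>\<^sup>+z. ennreal ((L2_set z {..<d})\<^sup>2) \<partial>gaussian d s) = ennreal (real d * s\<^sup>2)" .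
  have [measurable]: "(\<lambda>z. L2_set z {..<d}) \<in> borel_measurable (gaussian d s)"
    unfolding L2_set_def by measurable
  have "emeasure (gaussian d s) {z \<in> space (gaussian d s). 1 \<le> ennreal (1 / K\<^sup>2) * ennreal ((L2_set z {..<d})\<^sup>2)} \<le>
      ennreal (1 / K\<^sup>2) * (\<integral>\<^sup>+z. ennreal ((L2_set z {..<d})\<^sup>2) * indicator (space (gaussian d s)) z \<partial>gaussian d s)"
    by (intro nn_integral_Markov_inequality) measurable
  also have "(\<integral>\<^sup>+z. ennreal ((L2_set z {..<d})\<^sup>2) * indicator (space (gaussian d s)) z \<partial>gaussian d s) = ennreal (real d * s\<^sup>2)"
    unfolding I[symmetric] by (intro nn_integral_cong) simp
  also have "ennreal (1 / K\<^sup>2) * \<dots> = ennreal (real d * s\<^sup>2 / K\<^sup>2)"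
    by (simp flip: ennreal_mult)
  finally have M: "measure (gaussian d s) {z \<in> space (gaussian d s). 1 \<le> ennreal (1 / K\<^sup>2) * ennreal ((L2_set z {..<d})\<^sup>2)} \<le> real d * s\<^sup>2 / K\<^sup>2"
    by (simp add: emeasure_eq_measure)
  have "measure (gaussian d s) {z \<in> Rspace d. L2_set z {..<d} > K} \<le>
      measure (gaussian d s) {z \<in> space (gaussian d s). 1 \<le> ennreal (1 / K\<^sup>2) * ennreal ((L2_set z {..<d})\<^sup>2)}"
  proof (rule finite_measure_mono)
    show "{z \<in> Rspace d. L2_set z {..<d} > K} \<subseteq> {z \<in> space (gaussian d s). 1 \<le> ennreal (1 / K\<^sup>2) * ennreal ((L2_set z {..<d})\<^sup>2)}"
    proof safe
      fix z assume "z \<in> Rspace d" "K < L2_set z {..<d}"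
      then have "K\<^sup>2 \<le> (L2_set z {..<d})\<^sup>2" using K by (intro power_mono) auto
      then have "1 \<le> 1 / K\<^sup>2 * (L2_set z {..<d})\<^sup>2" using K by simp
      then show "1 \<le> ennreal (1 / K\<^sup>2) * ennreal ((L2_set z {..<d})\<^sup>2)"
        by (simp flip: ennreal_mult ennreal_1)
    qed simp
  qed measurable
  with M show ?thesis by linarith
qed

text \<open>\<open>G\<close> consists of the noise vectors of norm at most \<open>K\<close> whose
  projection to every direction between two centres is within \<open>e / 4\<close> of its mean. Its
  complement is bounded by the norm tail and a union bound over pairs of centres. For two vectors of
  \<open>G\<close> the means cancel, so their difference has projection at most
  \<open>e / 2\<close>.\<close>

lemma exists_direction_preserving_noise:
  assumes s: "0 \<le> s" "4 * s\<^sup>2 * k \<le> 1" "0 < k" and e: "0 < e" and K: "0 < K"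
    and C: "finite C" "S \<subseteq> (\<Union>c\<in>C. {x \<in> Rspace d. edist d c x < h})"
    and h: "h * (e + 4 * K) \<le> e\<^sup>2 / 2" "0 \<le> h"
  obtains G where "G \<in> sets (Rborel d)"
    "measure (gaussian d s) (Rspace d - G) \<le> real d * s\<^sup>2 / K\<^sup>2 + (real (card C))\<^sup>2 * (2 * exp (- (k * (e / 4)\<^sup>2)))"
    "\<And>x y z z'. x \<in> S \<Longrightarrow> y \<in> S \<Longrightarrow> z \<in> G \<Longrightarrow> z' \<in> G \<Longrightarrow> edist d x y \<le> edist d (padd d x z) (padd d y z') + e"
proof
  interpret prob_space "gaussian d s" by (rule prob_space_gaussian[OF s(1)])
  \<comment> \<open>The projection of \<open>z\<close> to the unit vector between two centres. For
    centres at distance 0, division by zero makes it the zero function, which is Lipschitz as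
    well.\<close>
  define l where "l q z = (\<Sum>i<d. (fst q i - snd q i) * z i) / edist d (fst q) (snd q)" for q :: "(nat \<Rightarrow> real) \<times> (nat \<Rightarrow> real)" and z
  have l_lip: "\<bar>l q z - l q z'\<bar> \<le> edist d z z'" for q z z'
  proof (cases "edist d (fst q) (snd q) = 0")
    case True
    then show ?thesis by (simp add: l_def)
  next
    case False
    then have pos: "0 < edist d (fst q) (snd q)" using edist_nonneg by (metis less_eq_real_def)
    have "l q z - l q z' = (\<Sum>i<d. (fst q i - snd q i) * (z i - z' i)) / edist d (fst q) (snd q)"
      by (simp add: l_def diff_divide_distrib[symmetric] sum_subtractf[symmetric] right_diff_distrib)
    then show ?thesis
      using inner_le_L2_set[of "\<lambda>i. fst q i - snd q i" "\<lambda>i. z i - z' i" "{..<d}"] pos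
      by (simp add: edist_L2_set divide_le_eq mult.commute)
  qed
  have l_meas: "l q \<in> borel_measurable (Rborel d)" for q
    by (rule Lipschitz_measurable) (rule l_lip)
  define m where "m q = expectation (l q)" for q
  let ?B = "\<lambda>q. {z \<in> Rspace d. \<bar>l q z - m q\<bar> > e / 4}" and ?T = "{z \<in> Rspace d. L2_set z {..<d} > K}"
  define G where "G = {z \<in> Rspace d. L2_set z {..<d} \<le> K \<and> (\<forall>q\<in>C \<times> C. \<bar>l q z - m q\<bar> \<le> e / 4)}"
  have B: "?B q \<in> sets (Rborel d)" for q
  proof -
    note l_meas[of q, measurable]
    have "{z \<in> space (Rborel d). \<bar>l q z - m q\<bar> > e / 4} \<in> sets (Rborel d)" by measurable
    then show ?thesis by simp
  qed
  have T: "?T \<in> sets (Rborel d)"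
  proof -
    have "{z \<in> space (Rborel d). L2_set z {..<d} > K} \<in> sets (Rborel d)" unfolding L2_set_def by measurable
    then show ?thesis by simp
  qed
  have comp: "Rspace d - G = ?T \<union> (\<Union>q\<in>C \<times> C. ?B q)"
  proof (rule set_eqI)
    show "z \<in> Rspace d - G \<longleftrightarrow> z \<in> ?T \<union> (\<Union>q\<in>C \<times> C. ?B q)" for z
      unfolding G_def mem_Collect_eq Diff_iff Un_iff UN_iff not_le[symmetric] by blast
  qed
  have Geq: "G = Rspace d - (?T \<union> (\<Union>q\<in>C \<times> C. ?B q))"
    unfolding comp[symmetric] by (auto simp: G_def)
  have U: "(\<Union>q\<in>C \<times> C. ?B q) \<in> sets (Rborel d)"
    using C(1) by (intro sets.finite_UN B) auto
  have "space (Rborel d) - (?T \<union> (\<Union>q\<in>C \<times> C. ?B q)) \<in> sets (Rborel d)"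
    by (intro sets.compl_sets sets.Un T U)
  then show "G \<in> sets (Rborel d)" by (simp only: Geq space_Rborel)
  have "prob (Rspace d - G) \<le> prob ?T + prob (\<Union>q\<in>C \<times> C. ?B q)"
    unfolding comp using T U by (intro measure_Un_le) auto
  also have "prob ?T \<le> real d * s\<^sup>2 / K\<^sup>2" by (rule gaussian_norm_tail[OF s(1) K])
  also have "prob (\<Union>q\<in>C \<times> C. ?B q) \<le> (\<Sum>q\<in>C \<times> C. prob (?B q))"
    using C(1) B by (intro measure_UNION_le) auto
  also have "\<dots> \<le> (\<Sum>q\<in>C \<times> C. 2 * exp (- (k * (e / 4)\<^sup>2)))"
    unfolding m_def using e by (intro sum_mono gaussian_concentration[OF s l_meas] l_lip) auto
  also have "\<dots> = (real (card C))\<^sup>2 * (2 * exp (- (k * (e / 4)\<^sup>2)))"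
    by (simp add: card_cartesian_product power2_eq_square)
  finally show "prob (Rspace d - G) \<le> real d * s\<^sup>2 / K\<^sup>2 + (real (card C))\<^sup>2 * (2 * exp (- (k * (e / 4)\<^sup>2)))"
    by simp
  fix x y z z' assume xy: "x \<in> S" "y \<in> S" and z: "z \<in> G" "z' \<in> G"
  obtain c c' where c: "c \<in> C" "edist d c x < h" "c' \<in> C" "edist d c' y < h"
    using xy C(2) by blast
  let ?w = "\<lambda>i. z i - z' i" and ?b = "\<lambda>i. c i - c' i"
  have "\<bar>\<Sum>i<d. ?b i * ?w i\<bar> \<le> e / 2 * L2_set ?b {..<d}"
  proof (cases "edist d c c' = 0")
    case True
    then show ?thesis using inner_le_L2_set[of ?b ?w "{..<d}"] by (simp add: edist_L2_set)
  next
    case False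
    then have pos: "0 < edist d c c'" using edist_nonneg by (metis less_eq_real_def)
    have "\<bar>l (c, c') z - m (c, c')\<bar> \<le> e / 4" "\<bar>l (c, c') z' - m (c, c')\<bar> \<le> e / 4"
      using z c by (auto simp: G_def)
    \<comment> \<open>Both projections are compared with the same mean
      \<open>m (c, c')\<close>.\<close>
    then have "\<bar>l (c, c') z - l (c, c') z'\<bar> \<le> e / 2" by linarith
    moreover have "l (c, c') z - l (c, c') z' = (\<Sum>i<d. ?b i * ?w i) / edist d c c'"
      by (simp add: l_def diff_divide_distrib[symmetric] sum_subtractf[symmetric] right_diff_distrib)
    ultimately show ?thesis using pos by (simp add: divide_le_eq edist_L2_set)
  qed
  moreover have "L2_set ?w {..<d} \<le> 2 * K"
    using L2_set_diff_le[of z z' "{..<d}"] z by (simp add: G_def)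
  moreover have "L2_set (\<lambda>i. (x i - y i) - ?b i) {..<d} \<le> 2 * h"
  proof -
    have "L2_set (\<lambda>i. (x i - y i) - ?b i) {..<d} = L2_set (\<lambda>i. (x i - c i) - (y i - c' i)) {..<d}"
      by (simp add: algebra_simps)
    also have "\<dots> \<le> edist d x c + edist d y c'"
      unfolding edist_L2_set by (rule L2_set_diff_le)
    also have "\<dots> \<le> 2 * h" using c by (simp add: edist_commute)
    finally show ?thesis .
  qed
  ultimately have "L2_set (\<lambda>i. x i - y i) {..<d} - e \<le> L2_set (\<lambda>i. (x i - y i) + ?w i) {..<d}"
    by (rule norm_add_almost_orthogonal) (use h e K in auto)
  also have "L2_set (\<lambda>i. (x i - y i) + ?w i) {..<d} = edist d (padd d x z) (padd d y z')"
    unfolding edist_L2_set by (intro L2_set_cong) (auto simp: padd_def)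
  finally show "edist d x y \<le> edist d (padd d x z) (padd d y z') + e" by (simp add: edist_L2_set)
qed

section \<open>The Gromov distance to the corruption\<close>

text \<open>The exceptional set is prescribed as a measurable set \<open>A\<close> of the
  parametrized space; its preimage has the same measure in the unit interval and contains all
  \<open>t\<close> where \<open>f\<close> and \<open>g\<close> differ by more than
  \<open>e\<close>.\<close>

lemma me1_le:
  assumes \<phi>: "parametrization N \<phi>" and A: "A \<in> sets N" "measure N A < e" and e: "0 < e"
    and fg: "\<And>t. t \<in> {0..1} \<Longrightarrow> \<phi> t \<notin> A \<Longrightarrow> \<bar>f t - g t\<bar> \<le> e"
  shows "me1 f g \<le> e"
  unfolding me1_def
proof (rule cInf_lower)
  show "bdd_below {e. e > 0 \<and> measure lebesgue {t \<in> {0..1}. \<bar>f t - g t\<bar> > e} < e}"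
    by (rule bdd_belowI[of _ 0]) auto
  let ?E = "{t \<in> {0..1}. \<bar>f t - g t\<bar> > e}" and ?A = "\<phi> -` A \<inter> space unit_lebesgue"
  have sp: "space unit_lebesgue = {0..1}" by (simp add: unit_lebesgue_def space_restrict_space)
  have meas: "?A \<in> sets unit_lebesgue" using \<phi> A(1) by (auto simp: parametrization_def)
  then have A': "?A \<in> sets lebesgue" unfolding unit_lebesgue_def by (subst (asm) sets_restrict_space_iff) auto
  have "emeasure lebesgue ?A \<le> emeasure lebesgue {0..1::real}"
    using sp by (intro emeasure_mono) auto
  then have fin: "?A \<in> fmeasurable lebesgue"
    using A' by (intro fmeasurableI) (auto intro: order_le_less_trans)
  have "measure lebesgue ?E \<le> measure lebesgue ?A"
  proof (cases "?E \<in> sets lebesgue")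
    case True
    have "?E \<subseteq> ?A"
    proof
      fix t assume t: "t \<in> ?E"
      then have "\<phi> t \<in> A" using fg[of t] by fastforce
      then show "t \<in> ?A" using t sp by simp
    qed
    then show ?thesis using True fin by (rule measure_mono_fmeasurable)
  next
    \<comment> \<open>\<open>measure\<close> is 0 on sets outside the sigma-algebra, so the estimate
      holds by convention.\<close>
    case False
    then show ?thesis by (simp add: measure_notin_sets)
  qed
  also have "\<dots> = measure unit_lebesgue ?A"
    unfolding unit_lebesgue_def using sp by (subst measure_restrict_space) (auto simp: unit_lebesgue_def)
  also have "\<dots> < e" using \<phi> A by (auto simp: parametrization_def)
  finally show "e \<in> {e. e > 0 \<and> measure lebesgue {t \<in> {0..1}. \<bar>f t - g t\<bar> > e} < e}"
    using e by simp
qed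

text \<open>One joint parametrization of point and noise serves both directions. Each yields
  \<open>me1 <= e\<close>; the bound \<open>2 * e\<close> leaves room for the strict inequality in
  the definition of \<open>d_conc\<close>.\<close>

lemma d_conc_corruption_le:
  assumes A: "prob_space A" "sets A = sets (restrict_space (Rborel d) S)"
    and S: "S \<in> sets (Rborel d)"
    and s: "0 \<le> s" "4 * s\<^sup>2 * k \<le> 1" "0 < k" and e: "0 < e" and conc: "2 * exp (- (k * e\<^sup>2)) < e"
    and G: "G \<in> sets (Rborel d)" "measure (gaussian d s) (Rspace d - G) < e"
      "\<And>x y z z'. x \<in> S \<Longrightarrow> y \<in> S \<Longrightarrow> z \<in> G \<Longrightarrow> z' \<in> G \<Longrightarrow> edist d x y \<le> edist d (padd d x z) (padd d y z') + e"
  shows "\<bar>d_conc (edist d) A (edist d) (distr (A \<Otimes>\<^sub>M gaussian d s) (Rborel d) (\<lambda>(x, z). padd d x z))\<bar> \<le> 2 * e"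
    (is "\<bar>d_conc _ _ _ ?Y\<bar> \<le> _")
proof -
  interpret A: prob_space A by fact
  interpret P: prob_space "gaussian d s" by (rule prob_space_gaussian[OF s(1)])
  interpret AP: pair_prob_space A "gaussian d s" ..
  let ?N = "A \<Otimes>\<^sub>M gaussian d s"
  have Ssub: "S \<subseteq> Rspace d" using sets.sets_into_space[OF S] by simp
  have spA: "space A = S" using sets_eq_imp_space_eq[OF A(2)] Ssub by (auto simp: space_restrict_space)
  have S0: "S \<noteq> {}" using A.not_empty spA by simp
  have spN: "space ?N = S \<times> Rspace d" by (simp add: space_pair_measure spA)
  have "sets ?N = sets (restrict_space (Rborel d) S \<Otimes>\<^sub>M Rborel d)"
    by (intro sets_pair_measure_cong A(2) sets_gaussian)
  then obtain \<Phi> where \<Phi>: "parametrization ?N \<Phi>"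
    using parametrization_exists_pair[OF AP.prob_space_axioms _ S S0] by blast
  have mA: "(\<lambda>x. x) \<in> A \<rightarrow>\<^sub>M Rborel d"
    unfolding measurable_cong_sets[OF A(2) refl] by (rule measurable_restrict_space1) simp
  have fst_meas: "fst \<in> ?N \<rightarrow>\<^sub>M Rborel d" using measurable_compose[OF measurable_fst mA] .
  have snd_meas: "snd \<in> ?N \<rightarrow>\<^sub>M Rborel d"
    using measurable_snd[of A "gaussian d s"] by (simp add: measurable_cong_sets[OF refl sets_gaussian])
  have add_meas: "(\<lambda>(x, z). padd d x z) \<in> ?N \<rightarrow>\<^sub>M Rborel d"
    using measurable_padd[OF fst_meas snd_meas] by (simp add: case_prod_beta')
  have parX: "parametrization A (\<lambda>t. fst (\<Phi> t))"
    using \<Phi> measurable_fst P.distr_pair_fst[symmetric] by (rule parametrization_comp)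
  have parY: "parametrization ?Y (\<lambda>t. (\<lambda>(x, z). padd d x z) (\<Phi> t))"
    using \<Phi> by (rule parametrization_comp) (use add_meas in \<open>auto intro: distr_cong\<close>)
  have \<Phi>_in: "\<Phi> t \<in> S \<times> Rspace d" if "t \<in> {0..1}" for t
    using \<Phi> that measurable_space[of \<Phi> unit_lebesgue ?N t]
    by (simp add: parametrization_def spN unit_lebesgue_def space_restrict_space)
  define \<phi>X where "\<phi>X t = fst (\<Phi> t)" for t
  define \<phi>Y where "\<phi>Y t = (\<lambda>(x, z). padd d x z) (\<Phi> t)" for t
  \<comment> \<open>The values \<open>f x\<close> at the points \<open>x + z\<close> with
    \<open>z\<close> in \<open>G\<close> are extended to all of \<open>R^d\<close>. The exceptional
    set is \<open>S\<close> times the complement of \<open>G\<close>.\<close>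
  have fwd: "\<exists>g\<in>Lip1 (edist d) ?Y. me1 (f \<circ> \<phi>X) (g \<circ> \<phi>Y) < 2 * e" if f: "f \<in> Lip1 (edist d) A" for f
  proof -
    have f_lip: "\<bar>f x - f y\<bar> \<le> edist d x y" if "x \<in> S" "y \<in> S" for x y
      using f that by (auto simp: Lip1_def spA)
    obtain g where g: "\<And>x y. \<bar>g x - g y\<bar> \<le> edist d x y"
      "\<And>q. q \<in> S \<times> G \<Longrightarrow> \<bar>g (padd d (fst q) (snd q)) - f (fst q)\<bar> \<le> e"
    proof (rule McShane_extension[of "S \<times> G" "\<lambda>q. f (fst q)" d "\<lambda>q. padd d (fst q) (snd q)" e])
      fix q q' assume "q \<in> S \<times> G" "q' \<in> S \<times> G"
      then show "\<bar>f (fst q) - f (fst q')\<bar> \<le> edist d (padd d (fst q) (snd q)) (padd d (fst q') (snd q')) + e"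
        using f_lip[of "fst q" "fst q'"] G(3)[of "fst q" "fst q'" "snd q" "snd q'"] by force
    qed blast
    have "me1 (f \<circ> \<phi>X) (g \<circ> \<phi>Y) \<le> e"
    proof (rule me1_le[OF \<Phi>])
      have G': "Rspace d - G \<in> sets (gaussian d s)"
        using sets.compl_sets[OF G(1)] by simp
      have S': "S \<in> sets A" using sets.top[of A] by (simp add: spA)
      show "S \<times> (Rspace d - G) \<in> sets ?N" using S' G' by (rule pair_measureI)
      have "emeasure ?N (S \<times> (Rspace d - G)) = emeasure A S * emeasure (gaussian d s) (Rspace d - G)"
        using S' G' by (rule P.emeasure_pair_measure_Times)
      also have "emeasure A S = 1" using A.emeasure_space_1 by (simp add: spA)
      finally have "measure ?N (S \<times> (Rspace d - G)) = measure (gaussian d s) (Rspace d - G)"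
        by (simp add: measure_def)
      then show "measure ?N (S \<times> (Rspace d - G)) < e" using G(2) by simp
      fix t :: real assume t: "t \<in> {0..1}" "\<Phi> t \<notin> S \<times> (Rspace d - G)"
      then have "\<Phi> t \<in> S \<times> G" using \<Phi>_in[OF t(1)] by (auto simp: mem_Times_iff)
      then show "\<bar>(f \<circ> \<phi>X) t - (g \<circ> \<phi>Y) t\<bar> \<le> e"
        using g(2) by (simp add: \<phi>X_def \<phi>Y_def case_prod_beta abs_minus_commute)
    qed (rule e)
    moreover have "g \<in> Lip1 (edist d) ?Y" using g(1) by (simp add: Lip1_def)
    ultimately show ?thesis using e by (intro bexI[of _ g]) auto
  qed
  have bwd: "\<exists>f\<in>Lip1 (edist d) A. me1 (f \<circ> \<phi>X) (g \<circ> \<phi>Y) < 2 * e" if g: "g \<in> Lip1 (edist d) ?Y" for g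
  proof -
    have g_lip: "\<bar>g x - g y\<bar> \<le> edist d x y" if "x \<in> Rspace d" "y \<in> Rspace d" for x y
      using g that by (auto simp: Lip1_def)
    have g_meas: "g \<in> borel_measurable (Rborel d)" using g_lip by (rule Lipschitz_measurable)
    have gx_lip: "\<bar>g (padd d x z) - g (padd d x z')\<bar> \<le> edist d z z'" for x z z'
      using g_lip[of "padd d x z" "padd d x z'"] by simp
    have gx_meas: "(\<lambda>z. g (padd d x z)) \<in> borel_measurable (Rborel d)" for x
      using gx_lip by (rule Lipschitz_measurable)
    have gx_int: "integrable (gaussian d s) (\<lambda>z. g (padd d x z))" for x
      using s gx_meas gx_lip by (rule integrable_Lipschitz_gaussian)
    \<comment> \<open>Averaging over the noise; translations are isometries, so the average is again
      1-Lipschitz.\<close>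
    define f where "f x = P.expectation (\<lambda>z. g (padd d x z))" for x
    have f_lip: "\<bar>f x - f y\<bar> \<le> edist d x y" for x y
    proof -
      have "f x - f y = P.expectation (\<lambda>z. g (padd d x z) - g (padd d y z))"
        unfolding f_def using gx_int by (simp add: Bochner_Integration.integral_diff)
      also have "\<bar>\<dots>\<bar> \<le> P.expectation (\<lambda>z. \<bar>g (padd d x z) - g (padd d y z)\<bar>)"
        by (rule integral_abs_bound)
      also have "\<dots> \<le> P.expectation (\<lambda>z. edist d x y)"
      proof (rule integral_mono)
        show "\<bar>g (padd d x z) - g (padd d y z)\<bar> \<le> edist d x y" for z
          using g_lip[of "padd d x z" "padd d y z"] by simp
      qed (use gx_int in \<open>auto intro!: Bochner_Integration.integrable_abs Bochner_Integration.integrable_diff\<close>)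
      also have "\<dots> = edist d x y" using P.prob_space by simp
      finally show ?thesis .
    qed
    have f_meas: "f \<in> borel_measurable (Rborel d)" using f_lip by (rule Lipschitz_measurable)
    let ?B = "{q \<in> space ?N. \<bar>g (padd d (fst q) (snd q)) - f (fst q)\<bar> > e}"
    have "(\<lambda>q. g (padd d (fst q) (snd q))) \<in> borel_measurable ?N" "(\<lambda>q. f (fst q)) \<in> borel_measurable ?N"
      using measurable_compose[OF measurable_padd[OF fst_meas snd_meas] g_meas] measurable_compose[OF fst_meas f_meas] by simp_all
    then have B: "?B \<in> sets ?N" by measurable
    have "me1 (f \<circ> \<phi>X) (g \<circ> \<phi>Y) \<le> e"
    proof (rule me1_le[OF \<Phi> B])
      have "emeasure ?N ?B = (\<integral>\<^sup>+x. emeasure (gaussian d s) (Pair x -` ?B) \<partial>A)"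
        using B by (rule P.emeasure_pair_measure_alt)
      \<comment> \<open>By Fubini it suffices to bound each fibre: for fixed \<open>x\<close> the
        function \<open>g (x + z)\<close> of the noise is 1-Lipschitz with mean \<open>f x\<close>,
        so concentration applies.\<close>
      also have "\<dots> \<le> (\<integral>\<^sup>+x. ennreal (2 * exp (- (k * e\<^sup>2))) \<partial>A)"
      proof (rule nn_integral_mono)
        fix x assume x: "x \<in> space A"
        then have "Pair x -` ?B = {z \<in> Rspace d. \<bar>g (padd d x z) - P.expectation (\<lambda>z. g (padd d x z))\<bar> > e}"
          by (auto simp: spN spA f_def)
        then show "emeasure (gaussian d s) (Pair x -` ?B) \<le> ennreal (2 * exp (- (k * e\<^sup>2)))"
          using gaussian_concentration[OF s gx_meas gx_lip e, of x] by (simp add: P.emeasure_eq_measure)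
      qed
      also have "\<dots> = ennreal (2 * exp (- (k * e\<^sup>2)))" by (simp add: A.emeasure_space_1)
      finally have "measure ?N ?B \<le> 2 * exp (- (k * e\<^sup>2))" by (simp add: AP.emeasure_eq_measure)
      then show "measure ?N ?B < e" using conc by simp
      fix t :: real assume t: "t \<in> {0..1}" "\<Phi> t \<notin> ?B"
      then have "\<bar>g (padd d (fst (\<Phi> t)) (snd (\<Phi> t))) - f (fst (\<Phi> t))\<bar> \<le> e"
        using \<Phi>_in[OF t(1)] by (simp add: spN not_less)
      then show "\<bar>(f \<circ> \<phi>X) t - (g \<circ> \<phi>Y) t\<bar> \<le> e"
        by (simp add: \<phi>X_def \<phi>Y_def case_prod_beta abs_minus_commute)
    qed (rule e)
    moreover have "f \<in> Lip1 (edist d) A" using f_lip by (simp add: Lip1_def)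
    ultimately show ?thesis using e by (intro bexI[of _ f]) auto
  qed
  let ?E = "{e. e > 0 \<and> (\<exists>\<phi>X \<phi>Y. parametrization A \<phi>X \<and> parametrization ?Y \<phi>Y \<and>
      (\<forall>f\<in>Lip1 (edist d) A. \<exists>g\<in>Lip1 (edist d) ?Y. me1 (f \<circ> \<phi>X) (g \<circ> \<phi>Y) < e) \<and>
      (\<forall>g\<in>Lip1 (edist d) ?Y. \<exists>f\<in>Lip1 (edist d) A. me1 (f \<circ> \<phi>X) (g \<circ> \<phi>Y) < e))}"
  have "parametrization A \<phi>X \<and> parametrization ?Y \<phi>Y \<and>
      (\<forall>f\<in>Lip1 (edist d) A. \<exists>g\<in>Lip1 (edist d) ?Y. me1 (f \<circ> \<phi>X) (g \<circ> \<phi>Y) < 2 * e) \<and>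
      (\<forall>g\<in>Lip1 (edist d) ?Y. \<exists>f\<in>Lip1 (edist d) A. me1 (f \<circ> \<phi>X) (g \<circ> \<phi>Y) < 2 * e)"
  proof (intro conjI ballI fwd bwd)
    show "parametrization A \<phi>X" using parX by (simp add: \<phi>X_def[abs_def])
    show "parametrization ?Y \<phi>Y" using parY by (simp add: \<phi>Y_def[abs_def])
  qed
  then have mem: "2 * e \<in> ?E" using e by (intro CollectI conjI) (simp, blast)
  have "bdd_below ?E" by (rule bdd_belowI[of _ 0]) simp
  with mem have "Inf ?E \<le> 2 * e" by (rule cInf_lower)
  \<comment> \<open>The infimum of the empty set is unspecified, so nonemptiness is required for the
    lower bound 0.\<close>
  moreover have "?E \<noteq> {}" using mem by blast
  then have "0 \<le> Inf ?E" by (rule cInf_greatest) simp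
  ultimately show ?thesis by (simp add: d_conc_def)
qed

text \<open>The convolution starts from the push-forward on \<open>R^d\<close>, the estimate from
  the push-forward on the subspace \<open>S\<close>. Both sides are the law of
  \<open>f x + z\<close> under the product of \<open>\<mu>\<close> and the Gaussian measure.\<close>

lemma conv_distr_eq:
  assumes \<mu>: "prob_space \<mu>" and f: "f \<in> \<mu> \<rightarrow>\<^sub>M Rborel d" and S: "\<And>x. x \<in> space \<mu> \<Longrightarrow> f x \<in> S" and s: "0 \<le> s"
  shows "conv d (distr \<mu> (Rborel d) f) (gaussian d s) =
    distr (distr \<mu> (restrict_space (Rborel d) S) f \<Otimes>\<^sub>M gaussian d s) (Rborel d) (\<lambda>(x, z). padd d x z)"
proof -
  interpret \<mu>: prob_space \<mu> by fact
  interpret P: prob_space "gaussian d s" by (rule prob_space_gaussian[OF s])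
  have fS: "f \<in> \<mu> \<rightarrow>\<^sub>M restrict_space (Rborel d) S" using f S by (intro measurable_restrict_space2) auto
  have *: "distr (distr \<mu> L f \<Otimes>\<^sub>M gaussian d s) (Rborel d) (\<lambda>(x, z). padd d x z) =
      distr (\<mu> \<Otimes>\<^sub>M gaussian d s) (Rborel d) (\<lambda>(x, z). padd d (f x) z)"
    if L: "f \<in> \<mu> \<rightarrow>\<^sub>M L" and id: "(\<lambda>x. x) \<in> L \<rightarrow>\<^sub>M Rborel d" for L
  proof -
    have "distr \<mu> L f \<Otimes>\<^sub>M gaussian d s = distr \<mu> L f \<Otimes>\<^sub>M distr (gaussian d s) (gaussian d s) (\<lambda>z. z)"
      by simp
    also have "\<dots> = distr (\<mu> \<Otimes>\<^sub>M gaussian d s) (L \<Otimes>\<^sub>M gaussian d s) (\<lambda>(x, z). (f x, z))"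
      by (rule pair_measure_distr[OF L]) (simp_all add: P.sigma_finite_measure_axioms)
    finally have eq: "distr \<mu> L f \<Otimes>\<^sub>M gaussian d s = distr (\<mu> \<Otimes>\<^sub>M gaussian d s) (L \<Otimes>\<^sub>M gaussian d s) (\<lambda>(x, z). (f x, z))" .
    have "(\<lambda>p. padd d (fst p) (snd p)) \<in> L \<Otimes>\<^sub>M gaussian d s \<rightarrow>\<^sub>M Rborel d"
      using measurable_compose[OF measurable_fst id] measurable_snd[of L "gaussian d s"]
      by (intro measurable_padd) (simp_all add: measurable_cong_sets[OF refl sets_gaussian])
    then show ?thesis
      unfolding eq using L by (subst distr_distr) (auto simp: case_prod_beta' comp_def)
  qed
  have "conv d (distr \<mu> (Rborel d) f) (gaussian d s) = distr (distr \<mu> (Rborel d) f \<Otimes>\<^sub>M gaussian d s) (Rborel d) (\<lambda>(x, z). padd d x z)"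
    by (simp add: conv_def padd_def)
  also have "\<dots> = distr (distr \<mu> (restrict_space (Rborel d) S) f \<Otimes>\<^sub>M gaussian d s) (Rborel d) (\<lambda>(x, z). padd d x z)"
    using *[OF f] *[OF fS] by (simp add: measurable_restrict_space1)
  finally show ?thesis .
qed

section \<open>Passage to the limit in the dimension\<close>

lemma power_exp_decay:
  assumes c: "0 < c"
  shows "(\<lambda>n. real n ^ k * exp (- (c * real n))) \<longlonglongrightarrow> 0"
proof -
  have "filterlim (\<lambda>n. c * real n) at_top sequentially"
    using c by (intro filterlim_tendsto_pos_mult_at_top[OF tendsto_const] filterlim_real_sequentially)
  from filterlim_compose[OF tendsto_power_div_exp_0 this]
  have "(\<lambda>n. (c * real n) ^ k / exp (c * real n)) \<longlonglongrightarrow> 0" .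
  then have "(\<lambda>n. 1 / c ^ k * ((c * real n) ^ k / exp (c * real n))) \<longlonglongrightarrow> 0"
    by (rule tendsto_mult_right_zero)
  moreover have "1 / c ^ k * ((c * real n) ^ k / exp (c * real n)) = real n ^ k * exp (- (c * real n))" for n
    using c by (simp add: power_mult_distrib exp_minus divide_inverse)
  ultimately show ?thesis by simp
qed

lemma continuous_map_Rtop_measurable:
  assumes f: "continuous_map M (Rtop d) f" and \<mu>: "sets \<mu> = sets (borel_of M)" "space \<mu> = topspace M"
  shows "f \<in> \<mu> \<rightarrow>\<^sub>M Rborel d"
proof (rule measurable_into_Rborel)
  fix i assume i: "i < d"
  have "continuous_map M euclideanreal (\<lambda>x. f x i)"
    using f i unfolding Rtop_def by (simp add: continuous_map_componentwise)
  then have "openin M {x \<in> topspace M. f x i \<in> U}" if "open U" for U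
    using that by (intro openin_continuous_map_preimage) auto
  moreover have "V \<in> sets \<mu>" if "openin M V" for V
    unfolding \<mu> borel_of_def using that openin_subset by (subst sets_measure_of) (auto intro: sigma_sets.Basic)
  ultimately show "(\<lambda>x. f x i) \<in> borel_measurable \<mu>"
    by (intro borel_measurableI) (simp add: vimage_def Int_def \<mu> conj_commute)
next
  show "f x \<in> Rspace d" if "x \<in> space \<mu>" for x
    using continuous_map_image_subset_topspace[OF f] that by (auto simp: \<mu>)
qed

text \<open>The estimate for one fixed dimension. Its numerical hypotheses \<open>conc\<close>,
  \<open>h\<close> and \<open>N\<close> are what the asymptotic assumptions have to supply for large
  \<open>d\<close>.\<close>

lemma d_conc_embedding_corruption_le:
  assumes \<mu>: "prob_space \<mu>" "sets \<mu> = sets (borel_of M)" "space \<mu> = topspace M" and M: "compact_space M"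
    and f: "continuous_map M (Rtop d) f"
    and s: "0 \<le> s" "4 * s\<^sup>2 * k \<le> 1" "0 < k" and e: "0 < e" and K: "0 < K"
    and conc: "2 * exp (- (k * e\<^sup>2)) < e"
    and h: "h * (e + 4 * K) \<le> e\<^sup>2 / 2" "0 < h"
    and N: "real d * s\<^sup>2 / K\<^sup>2 + (real (covering_number d (f ` topspace M) h))\<^sup>2 * (2 * exp (- (k * (e / 4)\<^sup>2))) < e"
  shows "\<bar>d_conc (edist d) (distr \<mu> (restrict_space (Rborel d) (f ` topspace M)) f)
      (edist d) (conv d (distr \<mu> (Rborel d) f) (gaussian d s))\<bar> \<le> 2 * e"
proof -
  interpret prob_space \<mu> by fact
  let ?S = "f ` topspace M"
  have S: "compactin (Rtop d) ?S" using M f by (auto simp: compact_space_def intro: image_compactin)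
  obtain C where C: "finite C" "card C = covering_number d ?S h" "C \<subseteq> Rspace d" "?S \<subseteq> (\<Union>c\<in>C. {x \<in> Rspace d. edist d c x < h})"
    by (rule compactin_Rtop_covering_number[OF S h(2)])
  obtain G where G: "G \<in> sets (Rborel d)"
    "measure (gaussian d s) (Rspace d - G) \<le> real d * s\<^sup>2 / K\<^sup>2 + (real (card C))\<^sup>2 * (2 * exp (- (k * (e / 4)\<^sup>2)))"
    "\<And>x y z z'. x \<in> ?S \<Longrightarrow> y \<in> ?S \<Longrightarrow> z \<in> G \<Longrightarrow> z' \<in> G \<Longrightarrow> edist d x y \<le> edist d (padd d x z) (padd d y z') + e"
    by (rule exists_direction_preserving_noise[OF s e K C(1,4) h(1) less_imp_le[OF h(2)]]) blast
  have fm: "f \<in> \<mu> \<rightarrow>\<^sub>M Rborel d" using f \<mu>(2,3) by (rule continuous_map_Rtop_measurable)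
  have fS: "f x \<in> ?S" if "x \<in> space \<mu>" for x using that \<mu>(3) by simp
  have eq: "conv d (distr \<mu> (Rborel d) f) (gaussian d s) =
      distr (distr \<mu> (restrict_space (Rborel d) ?S) f \<Otimes>\<^sub>M gaussian d s) (Rborel d) (\<lambda>(x, z). padd d x z)"
    using \<mu>(1) fm fS s(1) by (rule conv_distr_eq)
  show ?thesis
    unfolding eq
  proof (rule d_conc_corruption_le[OF _ _ compactin_Rtop_measurable[OF S] s e conc G(1) _ G(3)])
    show "prob_space (distr \<mu> (restrict_space (Rborel d) ?S) f)"
      using fm fS by (intro prob_space_distr measurable_restrict_space2) auto
    show "measure (gaussian d s) (Rspace d - G) < e" using G(2) N C(2) by simp
  qed simp_all
qed

theorem theorem11:
  fixes M :: "'a topology" and \<mu> :: "'a measure"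
    and \<iota> :: "nat \<Rightarrow> 'a \<Rightarrow> (nat \<Rightarrow> real)" and \<sigma> :: "nat \<Rightarrow> real"
  assumes "topological_manifold M" and "compact_space M"
    and "prob_space \<mu>" and "sets \<mu> = sets (borel_of M)" and "space \<mu> = topspace M"
    and "\<forall>\<^sub>F d in sequentially. embedding_map M (Rtop d) (\<iota> d)"
    and "\<And>e. e > 0 \<Longrightarrow>
           (\<lambda>d. real (covering_number d (\<iota> d ` topspace M) e)) \<in> o(\<lambda>d. real d)"
    and "\<And>d. \<sigma> d \<ge> 0"
    and "\<sigma> \<in> O(\<lambda>d. 1 / sqrt (real d))"
  shows "(\<lambda>d. d_conc
             (edist d) (distr \<mu> (restrict_space (Rborel d) (\<iota> d ` topspace M)) (\<iota> d))
             (edist d) (conv d (distr \<mu> (Rborel d) (\<iota> d)) (gaussian d (\<sigma> d))))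
          \<longlonglongrightarrow> 0"
proof (rule tendstoI)
  fix r :: real assume "0 < r"
  define e where "e = r / 3"
  have e: "0 < e" using \<open>0 < r\<close> by (simp add: e_def)
  obtain B where B: "0 < B" "\<forall>\<^sub>F d in sequentially. norm (\<sigma> d) \<le> B * norm (1 / sqrt (real d))"
    using landau_o.bigE[OF assms(9)] by blast
  \<comment> \<open>Chosen so that the norm tail \<open>d * s^2 / K^2\<close>, at most
    \<open>B^2 / K^2\<close>, is at most \<open>e / 4\<close>.\<close>
  define K where "K = 2 * B / sqrt e"
  have K: "0 < K" "B\<^sup>2 / K\<^sup>2 = e / 4"
    using B e by (simp_all add: K_def power_divide power_mult_distrib)
  \<comment> \<open>The radius of the cover; it satisfies \<open>h * (e + 4 * K) = e^2 / 2\<close>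
    and does not depend on \<open>d\<close>, so the covering assumption applies to it.\<close>
  define h where "h = e\<^sup>2 / (2 * (e + 4 * K))"
  have "0 < e + 4 * K" using e K by simp
  then have h: "0 < h" "h * (e + 4 * K) \<le> e\<^sup>2 / 2"
    using e unfolding h_def by (simp_all only: divide_pos_pos zero_less_power mult_pos_pos zero_less_numeral)
      (simp add: field_simps)
  \<comment> \<open>The concentration constant will be \<open>k = b * d\<close>; since
    \<open>d * s^2 <= B^2\<close>, it satisfies \<open>4 * s^2 * k <= 1\<close>.\<close>
  define b where "b = 1 / (4 * B\<^sup>2)"
  have b: "0 < b" using B by (simp add: b_def)
  have cover: "\<forall>\<^sub>F d in sequentially. real (covering_number d (\<iota> d ` topspace M) h) \<le> real d"
    using landau_o.smallD[OF assms(7)[OF h(1)], of 1] by simp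
  \<comment> \<open>The power 0 is for the concentration of a single Lipschitz function; the power 2
    further below is for the union bound over at most \<open>d^2\<close> pairs of centres.\<close>
  have "(\<lambda>d. 2 * (real d ^ 0 * exp (- (b * e\<^sup>2 * real d)))) \<longlonglongrightarrow> 2 * 0"
    using b e by (intro tendsto_mult_left power_exp_decay) simp
  then have ev1: "\<forall>\<^sub>F d in sequentially. 2 * (real d ^ 0 * exp (- (b * e\<^sup>2 * real d))) < e"
    by (rule order_tendstoD(2)) (use e in simp)
  have "(\<lambda>d. 2 * (real d ^ 2 * exp (- (b * (e / 4)\<^sup>2 * real d)))) \<longlonglongrightarrow> 2 * 0"
    using b e by (intro tendsto_mult_left power_exp_decay) simp
  then have ev2: "\<forall>\<^sub>F d in sequentially. 2 * (real d ^ 2 * exp (- (b * (e / 4)\<^sup>2 * real d))) < e / 2"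
    by (rule order_tendstoD(2)) (use e in simp)
  show "\<forall>\<^sub>F d in sequentially. dist (d_conc
             (edist d) (distr \<mu> (restrict_space (Rborel d) (\<iota> d ` topspace M)) (\<iota> d))
             (edist d) (conv d (distr \<mu> (Rborel d) (\<iota> d)) (gaussian d (\<sigma> d)))) 0 < r"
    using assms(6) B(2) cover ev1 ev2 eventually_gt_at_top[of 0]
  proof eventually_elim
    case (elim d)
    let ?N = "real (covering_number d (\<iota> d ` topspace M) h)"
    have "\<sigma> d \<le> B / sqrt (real d)" using elim(2) assms(8)[of d] by simp
    then have "(\<sigma> d)\<^sup>2 \<le> (B / sqrt (real d))\<^sup>2" using assms(8) by (intro power_mono)
    then have \<sigma>: "(\<sigma> d)\<^sup>2 * real d \<le> B\<^sup>2" using elim(6) by (simp add: power_divide pos_le_divide_eq)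
    have "\<bar>d_conc
             (edist d) (distr \<mu> (restrict_space (Rborel d) (\<iota> d ` topspace M)) (\<iota> d))
             (edist d) (conv d (distr \<mu> (Rborel d) (\<iota> d)) (gaussian d (\<sigma> d)))\<bar> \<le> 2 * e"
    proof (rule d_conc_embedding_corruption_le[OF assms(3-5,2)])
      show "continuous_map M (Rtop d) (\<iota> d)"
        using homeomorphic_imp_continuous_map[OF elim(1)[unfolded embedding_map_def]]
        by (simp add: continuous_map_in_subtopology)
      show "4 * (\<sigma> d)\<^sup>2 * (b * real d) \<le> 1" using \<sigma> B by (simp add: b_def mult.commute)
      show "0 < b * real d" using b elim(6) by simp
      show "2 * exp (- (b * real d * e\<^sup>2)) < e" using elim(4) by (simp add: mult_ac)
      \<comment> \<open>The two contributions to the measure of bad noise are at most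
        \<open>e / 4\<close> and less than \<open>e / 2\<close>, so they add up to less than
        \<open>e\<close>.\<close>
      have "real d * (\<sigma> d)\<^sup>2 / K\<^sup>2 \<le> B\<^sup>2 / K\<^sup>2"
        using \<sigma> by (intro divide_right_mono) (auto simp: mult.commute)
      also have "\<dots> = e / 4" by (rule K)
      finally have 1: "real d * (\<sigma> d)\<^sup>2 / K\<^sup>2 \<le> e / 4" .
      have "?N\<^sup>2 * (2 * exp (- (b * real d * (e / 4)\<^sup>2))) \<le> (real d)\<^sup>2 * (2 * exp (- (b * real d * (e / 4)\<^sup>2)))"
        using elim(3) by (intro mult_right_mono power_mono) auto
      also have "\<dots> < e / 2" using elim(5) by (simp add: mult_ac)
      finally show "real d * (\<sigma> d)\<^sup>2 / K\<^sup>2 + ?N\<^sup>2 * (2 * exp (- (b * real d * (e / 4)\<^sup>2))) < e"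
        using 1 e by linarith
    qed (use e K h assms(8) in auto)
    also have "2 * e < r" using \<open>0 < r\<close> by (simp add: e_def)
    finally show ?case by (simp add: dist_real_def)
  qed
qed

end
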